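(* The quotiented Bannai--Ito algebra $\overline{I}_3$ (defined in the context) is isomorphic, as an algebra, to the centralizer $$\mathrm{End}_{\mathfrak{osp}(1|2)}\left(\left[\tfrac12\right]^+\otimes\left[\tfrac12\right]^+\otimes\left[\tfrac12\right]^+\right)$$ of the action of the Lie superalgebra $\mathfrak{osp}(1|2)$ on the threefold tensor product of its fundamental bosonic representation $\left[\tfrac12\right]^+$.
   Context: All vector spaces and algebras are over $\mathbb{C}$; algebras are unital and associative; $\{A,B\}=AB+BA$ and $[A,B]=AB-BA$. The universal Bannai--Ito algebra $I_3$ is the algebra generated by $X,Y,Z$ and three central elements $\omega_X,\omega_Y,\omega_Z$ with defining relations $$\{X,Y\}=X+Y+Z+\omega_Z,\qquad \{X,Z\}=X+Y+Z+\omega_Y,\qquad \{Y,Z\}=X+Y+Z+\omega_X.$$ The algebra $\overline{I}_3$ is the quotient of $I_3$ by the relations $\omega_X=\omega_Y=\omega_Z=\omega$ and $$X(X^2-4)=0,\qquad Y(Y^2-4)=0,\qquad Z(Z^2-4)=0,$$ $$(\omega+4)(\omega-2)(\omega-8)(\omega-14)=0,$$ $$(X-\omega+16)(X-\omega+10)(X-\omega+8)(X-\omega+6)(X-\omega)(X-\omega-2)(X-\omega-6)=0,$$ $$(Y-\omega+16)(Y-\omega+10)(Y-\omega+8)(Y-\omega+6)(Y-\omega)(Y-\omega-2)(Y-\omega-6)=0,$$ $$(Z-\omega+16)(Z-\omega+10)(Z-\omega+8)(Z-\omega+6)(Z-\omega)(Z-\omega-2)(Z-\omega-6)=0.$$ The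 Lie superalgebra $\mathfrak{osp}(1|2)$ has odd generators $F^\pm$ and even generators $H,E^\pm$ with relations $$[H,E^\pm]=\pm E^\pm,\quad [E^+,E^-]=2H,\quad [H,F^\pm]=\pm\tfrac12F^\pm,\quad \{F^+,F^-\}=\tfrac12H,\quad [E^\pm,F^\mp]=-F^\pm,\quad \{F^\pm,F^\pm\}=\pm\tfrac12E^\pm.$$ The $\mathbb{Z}_2$-grading is encoded by a grading involution $R$ with $[R,E^\pm]=0$, $[R,H]=0$, $\{R,F^\pm\}=0$, $R^2=1$. The algebra $U(\mathfrak{osp}(1|2))$ (including $R$) has the coproduct, an algebra homomorphism into the ordinary (unsigned) tensor product algebra, $$\Delta(E^\pm)=E^\pm\otimes1+1\otimes E^\pm,\quad \Delta(H)=H\otimes1+1\otimes H,\quad \Delta(F^\pm)=F^\pm\otimes R+1\otimes F^\pm,\quad \Delta(R)=R\otimes R.$$ The fundamental bosonic representation $\left[\tfrac12\right]^+$ is the $3$-dimensional representation given by $$H=\frac12\begin{pmatrix}1&0&0\\0&-1&0\\0&0&0\end{pmatrix},\quad F^+=\frac12\begin{pmatrix}0&0&1\\0&0&0\\0&1&0\end{pmatrix},\quad F^-=\frac12\begin{pmatrix}0&0&0\\0&0&-1\\1&0&0\end{pmatrix},$$ $E^\pm=\pm4(F^\pm)^2$, and $R=\mathrm{diag}(1,1,-1)$. Let $\mathcal{V}=\left[\tfrac12\right]^+\otimes\left[\tfrac12\right]^+\otimes\left[\tfrac12\right]^+$, on which $g\in\mathfrak{osp}(1|2)$ acts through $(\Delta\otimes1)\Delta(g)$.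 The centralizer is $$\mathrm{End}_{\mathfrak{osp}(1|2)}(\mathcal{V})=\{M\in\mathrm{End}(\mathcal{V})\ |\ M(g\cdot v)=g\cdot(Mv)\ \text{ for all } v\in\mathcal{V},\ g\in\mathfrak{osp}(1|2)\}.$$ *)

theory Defs
  imports "HOL-Analysis.Analysis" "HOL-Library.Poly_Mapping" "HOL-Algebra.QuotRing" "HOL-Algebra.Module"
begin

section \<open>Unital associative algebras over the complex numbers\<close>

text \<open>The record type \<open>module\<close> of HOL-Algebra extends a ring by a scalar multiplication; the
  library locale \<open>algebra\<close> is restricted to commutative rings.\<close>

locale calgebra = ring A for A :: "(complex, 'a) module" (structure) +
  assumes smult_closed [simp, intro]: "x \<in> carrier A \<Longrightarrow> c \<odot> x \<in> carrier A"
    and smult_l_distr: "x \<in> carrier A \<Longrightarrow> (c + d) \<odot> x = (c \<odot> x) \<oplus> (d \<odot> x)"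
    and smult_r_distr: "\<lbrakk>x \<in> carrier A; y \<in> carrier A\<rbrakk> \<Longrightarrow> c \<odot> (x \<oplus> y) = (c \<odot> x) \<oplus> (c \<odot> y)"
    and smult_assoc1: "x \<in> carrier A \<Longrightarrow> (c * d) \<odot> x = c \<odot> (d \<odot> x)"
    and smult_one: "x \<in> carrier A \<Longrightarrow> 1 \<odot> x = x"
    and smult_mult_l: "\<lbrakk>x \<in> carrier A; y \<in> carrier A\<rbrakk> \<Longrightarrow> (c \<odot> x) \<otimes> y = c \<odot> (x \<otimes> y)"
    and smult_mult_r: "\<lbrakk>x \<in> carrier A; y \<in> carrier A\<rbrakk> \<Longrightarrow> x \<otimes> (c \<odot> y) = c \<odot> (x \<otimes> y)"

definition calg_iso :: "(complex, 'a) module \<Rightarrow> (complex, 'b) module \<Rightarrow> ('a \<Rightarrow> 'b) set" where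
  "calg_iso A B =
    {\<phi> \<in> ring_iso A B. \<forall>c. \<forall>x \<in> carrier A. \<phi> (c \<odot>\<^bsub>A\<^esub> x) = c \<odot>\<^bsub>B\<^esub> \<phi> x}"

definition calg_isomorphic :: "(complex, 'a) module \<Rightarrow> (complex, 'b) module \<Rightarrow> bool" where
  "calg_isomorphic A B \<longleftrightarrow> calg_iso A B \<noteq> {}"

text \<open>\<open>calg_quot A S\<close> is the quotient of \<open>A\<close> by the two-sided ideal generated by \<open>S\<close>,
  that is, by the relations \<open>r = 0\<close> for \<open>r\<close> in \<open>S\<close>; \<open>calg_proj A S\<close> is the projection.\<close>

definition calg_proj :: "(complex, 'a) module \<Rightarrow> 'a set \<Rightarrow> 'a \<Rightarrow> 'a set" where
  "calg_proj A S x = (Idl\<^bsub>A\<^esub> S) +>\<^bsub>A\<^esub> x"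

definition calg_quot :: "(complex, 'a) module \<Rightarrow> 'a set \<Rightarrow> (complex, 'a set) module" where
  "calg_quot A S =
    (let Q = A Quot (Idl\<^bsub>A\<^esub> S) in
     \<lparr>carrier = carrier Q, mult = mult Q, one = one Q, zero = zero Q, add = add Q,
      smult = (\<lambda>c C. \<Union>x\<in>C. calg_proj A S (c \<odot>\<^bsub>A\<^esub> x))\<rparr>)"

lemma calg_quot_simps:
  "carrier (calg_quot A S) = carrier (A Quot (Idl\<^bsub>A\<^esub> S))"
  "mult (calg_quot A S) = mult (A Quot (Idl\<^bsub>A\<^esub> S))"
  "one (calg_quot A S) = one (A Quot (Idl\<^bsub>A\<^esub> S))"
  "zero (calg_quot A S) = zero (A Quot (Idl\<^bsub>A\<^esub> S))"
  "add (calg_quot A S) = add (A Quot (Idl\<^bsub>A\<^esub> S))"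
  "smult (calg_quot A S) = (\<lambda>c C. \<Union>x\<in>C. calg_proj A S (c \<odot>\<^bsub>A\<^esub> x))"
  by (simp_all add: calg_quot_def Let_def)

lemma ring_transfer:
  fixes R :: "('a, 'b) ring_scheme" and Q :: "('a, 'c) ring_scheme"
  assumes "ring Q" "carrier R = carrier Q" "mult R = mult Q" "one R = one Q"
    "zero R = zero Q" "add R = add Q"
  shows "ring R"
proof -
  interpret Q: ring Q by fact
  show ?thesis
  proof (rule ringI)
    show "abelian_group R"
    proof (rule abelian_groupI)
      fix x assume "x \<in> carrier R"
      then show "\<exists>y\<in>carrier R. y \<oplus>\<^bsub>R\<^esub> x = \<zero>\<^bsub>R\<^esub>"
        using assms Q.l_neg[of x] Q.a_inv_closed[of x] by auto
    qed (auto simp: assms Q.a_ac)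
    show "Group.monoid R"
      by (rule monoidI) (auto simp: assms Q.m_assoc)
  qed (auto simp: assms Q.l_distr Q.r_distr)
qed

context calgebra
begin

lemma ideal_smult:
  assumes "ideal I A" "x \<in> I"
  shows "c \<odot> x \<in> I"
proof -
  interpret ideal I A by fact
  have x: "x \<in> carrier A" using assms(2) by (rule a_Hcarr)
  have "c \<odot> x = (c \<odot> \<one>) \<otimes> x" using x by (simp add: smult_mult_l)
  then show ?thesis using I_l_closed[OF assms(2)] by simp
qed

lemma calg_quot_smult:
  assumes "S \<subseteq> carrier A" "x \<in> carrier A"
  shows "c \<odot>\<^bsub>calg_quot A S\<^esub> calg_proj A S x = calg_proj A S (c \<odot> x)"
proof -
  interpret ideal "Idl S" A by (rule genideal_ideal[OF assms(1)])
  have eq: "calg_proj A S (c \<odot> y) = calg_proj A S (c \<odot> x)" if y: "y \<in> calg_proj A S x" for y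
  proof -
    obtain i where i: "i \<in> Idl S" "y = i \<oplus> x"
      using y by (auto simp: calg_proj_def a_r_coset_def')
    have "c \<odot> y = (c \<odot> i) \<oplus> (c \<odot> x)"
      using i assms(2) a_Hcarr[OF i(1)] by (simp add: smult_r_distr)
    moreover have "c \<odot> i \<in> Idl S"
      using ideal_smult[OF ideal_axioms i(1)] .
    ultimately have "c \<odot> y \<in> Idl S +> (c \<odot> x)"
      by (auto simp: a_r_coset_def')
    then show ?thesis
      unfolding calg_proj_def using a_repr_independence'[of "c \<odot> y" "c \<odot> x"] assms(2) by simp
  qed
  have x: "x \<in> calg_proj A S x"
    unfolding calg_proj_def by (rule a_rcos_self[OF assms(2)])
  have "(\<Union>y\<in>calg_proj A S x. calg_proj A S (c \<odot> y)) = (\<Union>y\<in>calg_proj A S x. calg_proj A S (c \<odot> x))"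
    by (intro SUP_cong refl eq)
  also have "\<dots> = calg_proj A S (c \<odot> x)"
    using x by blast
  finally show ?thesis by (simp only: calg_quot_simps)
qed

lemma carrier_calg_quot: "carrier (calg_quot A S) = calg_proj A S ` carrier A"
  by (auto simp: calg_quot_simps FactRing_simps calg_proj_def)

lemma calgebra_calg_quot:
  assumes "S \<subseteq> carrier A"
  shows "calgebra (calg_quot A S)"
proof -
  interpret I: ideal "Idl S" A by (rule genideal_ideal[OF assms])
  interpret Q: ring "calg_quot A S"
    by (rule ring_transfer[OF I.quotient_is_ring]) (simp_all add: calg_quot_simps)
  have add: "calg_proj A S x \<oplus>\<^bsub>calg_quot A S\<^esub> calg_proj A S y = calg_proj A S (x \<oplus> y)"
    if "x \<in> carrier A" "y \<in> carrier A" for x y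
    using that by (simp add: calg_quot_simps FactRing_simps calg_proj_def I.a_rcos_sum)
  have mul: "calg_proj A S x \<otimes>\<^bsub>calg_quot A S\<^esub> calg_proj A S y = calg_proj A S (x \<otimes> y)"
    if "x \<in> carrier A" "y \<in> carrier A" for x y
    using that by (simp add: calg_quot_simps FactRing_simps calg_proj_def I.rcoset_mult_add)
  show ?thesis
    by unfold_locales
      (auto simp: carrier_calg_quot calg_quot_smult[OF assms] add mul smult_l_distr
        smult_r_distr smult_assoc1 smult_one smult_mult_l smult_mult_r)
qed

end


section \<open>Free algebras\<close>

text \<open>The free algebra on a set of generators is the monoid algebra of the free monoid, whose
  operation is written additively as required by \<open>Poly_Mapping\<close>.\<close>

datatype 'g fmon = Word "'g list"

instantiation fmon :: (type) monoid_add
begin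

definition zero_fmon :: "'a fmon" where "zero_fmon = Word []"

fun plus_fmon :: "'a fmon \<Rightarrow> 'a fmon \<Rightarrow> 'a fmon" where
  "plus_fmon (Word u) (Word v) = Word (u @ v)"

instance
proof
  fix a b c :: "'a fmon"
  show "a + b + c = a + (b + c)" by (cases a; cases b; cases c) simp
  show "0 + a = a" by (cases a) (simp add: zero_fmon_def)
  show "a + 0 = a" by (cases a) (simp add: zero_fmon_def)
qed

end

type_synonym 'g falg = "'g fmon \<Rightarrow>\<^sub>0 complex"

definition gen :: "'g \<Rightarrow> 'g falg" where
  "gen g = Poly_Mapping.single (Word [g]) 1"

definition free_calg :: "(complex, 'g falg) module" where
  "free_calg = \<lparr>carrier = UNIV, mult = (*), one = 1, zero = 0, add = (+),
     smult = (\<lambda>c p. Poly_Mapping.single 0 c * p)\<rparr>"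

lemma single_0_commute:
  "Poly_Mapping.single 0 (c :: complex) * p = p * Poly_Mapping.single (0 :: 'g fmon) c"
proof (induction p rule: update_induct)
  case (update f a b)
  have "Poly_Mapping.update a b f = f + Poly_Mapping.single a b"
    using update(1) by (intro poly_mapping_eqI) (auto simp: lookup_update lookup_add lookup_single in_keys_iff when_def)
  with update(3) show ?case by (simp add: distrib_left distrib_right mult_single mult.commute)
qed simp

lemma calgebra_free_calg: "calgebra (free_calg :: (complex, 'g falg) module)"
proof -
  have "ring (free_calg :: (complex, 'g falg) module)"
  proof (rule ringI)
    show "abelian_group (free_calg :: (complex, 'g falg) module)"
    proof (rule abelian_groupI)
      fix x :: "'g falg"
      show "\<exists>y\<in>carrier free_calg. y \<oplus>\<^bsub>free_calg\<^esub> x = \<zero>\<^bsub>free_calg\<^esub>"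
        by (rule bexI[of _ "- x"]) (simp_all add: free_calg_def)
    qed (auto simp: free_calg_def ac_simps)
    show "Group.monoid (free_calg :: (complex, 'g falg) module)"
      by (rule monoidI) (auto simp: free_calg_def mult.assoc)
  qed (auto simp: free_calg_def algebra_simps)
  then interpret ring "free_calg :: (complex, 'g falg) module" .
  have r: "x * (Poly_Mapping.single 0 c * y) = Poly_Mapping.single 0 c * (x * y)"
    for c and x y :: "'g falg"
    by (metis mult.assoc single_0_commute)
  have m: "Poly_Mapping.single 0 (c * d) = Poly_Mapping.single 0 c * Poly_Mapping.single (0 :: 'g fmon) d"
    for c d :: complex
    by (simp add: mult_single)
  show ?thesis
    by unfold_locales
      (simp_all add: free_calg_def single_add distrib_left distrib_right m mult.assoc, rule r)
qed


section \<open>The Bannai--Ito algebra and its quotient\<close>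

datatype bi_gen = BI_X | BI_Y | BI_Z | BI_omega_X | BI_omega_Y | BI_omega_Z

definition bi_rels :: "bi_gen falg set" where
  "bi_rels =
    (let X = gen BI_X; Y = gen BI_Y; Z = gen BI_Z;
         wX = gen BI_omega_X; wY = gen BI_omega_Y; wZ = gen BI_omega_Z in
     {(X * Y + Y * X) - (X + Y + Z + wZ),
      (X * Z + Z * X) - (X + Y + Z + wY),
      (Y * Z + Z * Y) - (X + Y + Z + wX)} \<union>
     {w * gen g - gen g * w | w g. w \<in> {wX, wY, wZ}})"

definition bannai_ito :: "(complex, bi_gen falg set) module" where
  "bannai_ito = calg_quot free_calg bi_rels"

definition bi_septic :: "bi_gen falg \<Rightarrow> bi_gen falg \<Rightarrow> bi_gen falg" where
  "bi_septic w T = (T - w + 16) * (T - w + 10) * (T - w + 8) * (T - w + 6)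
     * (T - w) * (T - w - 2) * (T - w - 6)"

text \<open>The common value \<open>\<omega>\<close> of the three central generators is represented by \<open>\<omega>\<^sub>X\<close>.\<close>

definition bi_bar_rels :: "bi_gen falg set" where
  "bi_bar_rels =
    (let X = gen BI_X; Y = gen BI_Y; Z = gen BI_Z;
         wX = gen BI_omega_X; wY = gen BI_omega_Y; wZ = gen BI_omega_Z; w = wX in
     {wY - w, wZ - w,
      X * (X^2 - 4), Y * (Y^2 - 4), Z * (Z^2 - 4),
      (w + 4) * (w - 2) * (w - 8) * (w - 14),
      bi_septic w X, bi_septic w Y, bi_septic w Z})"

definition bannai_ito_bar :: "(complex, bi_gen falg set set) module" where
  "bannai_ito_bar = calg_quot bannai_ito (calg_proj free_calg bi_rels ` bi_bar_rels)"

lemma calgebra_bannai_ito: "calgebra bannai_ito"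
  unfolding bannai_ito_def
  by (rule calgebra.calgebra_calg_quot[OF calgebra_free_calg]) (simp add: free_calg_def)

lemma calgebra_bannai_ito_bar: "calgebra bannai_ito_bar"
  unfolding bannai_ito_bar_def
  by (rule calgebra.calgebra_calg_quot[OF calgebra_bannai_ito])
    (simp add: bannai_ito_def calgebra.carrier_calg_quot[OF calgebra_free_calg] image_mono,
     simp add: free_calg_def image_mono)


section \<open>Representations of osp(1|2)\<close>

type_synonym 'n cmat = "complex ^ 'n ^ 'n"

definition smat :: "complex \<Rightarrow> 'n::finite cmat \<Rightarrow> 'n cmat" where
  "smat c A = (\<chi> i j. c * A $ i $ j)"

definition kron :: "'a::finite cmat \<Rightarrow> 'b::finite cmat \<Rightarrow> ('a \<times> 'b) cmat" where
  "kron A B = (\<chi> i j. A $ fst i $ fst j * B $ snd i $ snd j)"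

definition comm_mat :: "'n::finite cmat \<Rightarrow> 'n cmat \<Rightarrow> 'n cmat" where
  "comm_mat A B = A ** B - B ** A"

definition anticomm_mat :: "'n::finite cmat \<Rightarrow> 'n cmat \<Rightarrow> 'n cmat" where
  "anticomm_mat A B = A ** B + B ** A"

datatype osp_basis = E_plus | E_minus | H_zero | F_plus | F_minus

text \<open>An element of the Lie superalgebra is given by its coordinates in the basis
  \<open>E\<^sup>+, E\<^sup>-, H, F\<^sup>+, F\<^sup>-\<close>.\<close>

type_synonym osp = "osp_basis \<Rightarrow> complex"

lemma UNIV_osp_basis: "UNIV = {E_plus, E_minus, H_zero, F_plus, F_minus}"
  by (auto intro: osp_basis.exhaust)

instance osp_basis :: finite
  by standard (simp add: UNIV_osp_basis)

text \<open>Generators of the enveloping algebra, including the grading involution \<open>R\<close>.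
  A representation is given by the matrices of these generators.\<close>

datatype uosp_gen = Osp osp_basis | R_inv

definition osp_rep :: "(uosp_gen \<Rightarrow> 'n::finite cmat) \<Rightarrow> bool" where
  "osp_rep \<rho> \<longleftrightarrow>
    (let Ep = \<rho> (Osp E_plus); Em = \<rho> (Osp E_minus); H = \<rho> (Osp H_zero);
         Fp = \<rho> (Osp F_plus); Fm = \<rho> (Osp F_minus); R = \<rho> R_inv in
     comm_mat H Ep = Ep \<and> comm_mat H Em = - Em \<and>
     comm_mat Ep Em = smat 2 H \<and>
     comm_mat H Fp = smat (1/2) Fp \<and> comm_mat H Fm = smat (- 1/2) Fm \<and>
     anticomm_mat Fp Fm = smat (1/2) H \<and>
     comm_mat Ep Fm = - Fp \<and> comm_mat Em Fp = - Fm \<and>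
     anticomm_mat Fp Fp = smat (1/2) Ep \<and> anticomm_mat Fm Fm = smat (- 1/2) Em \<and>
     comm_mat R Ep = 0 \<and> comm_mat R Em = 0 \<and> comm_mat R H = 0 \<and>
     anticomm_mat R Fp = 0 \<and> anticomm_mat R Fm = 0 \<and> R ** R = mat 1)"

definition osp_act :: "(uosp_gen \<Rightarrow> 'n::finite cmat) \<Rightarrow> osp \<Rightarrow> 'n cmat" where
  "osp_act \<rho> g = (\<Sum>b\<in>UNIV. smat (g b) (\<rho> (Osp b)))"

text \<open>The tensor product of two representations is \<open>(\<rho> \<otimes> \<sigma>) \<circ> \<Delta>\<close>. Hence
  \<open>tensor_rep (tensor_rep \<rho> \<sigma>) \<tau>\<close> is \<open>(\<rho> \<otimes> \<sigma> \<otimes> \<tau>) \<circ> (\<Delta> \<otimes> 1) \<circ> \<Delta>\<close>.\<close>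

fun tensor_rep ::
  "(uosp_gen \<Rightarrow> 'a::finite cmat) \<Rightarrow> (uosp_gen \<Rightarrow> 'b::finite cmat) \<Rightarrow> uosp_gen \<Rightarrow> ('a \<times> 'b) cmat"
where
  "tensor_rep \<rho> \<sigma> (Osp E_plus) = kron (\<rho> (Osp E_plus)) (mat 1) + kron (mat 1) (\<sigma> (Osp E_plus))"
| "tensor_rep \<rho> \<sigma> (Osp E_minus) = kron (\<rho> (Osp E_minus)) (mat 1) + kron (mat 1) (\<sigma> (Osp E_minus))"
| "tensor_rep \<rho> \<sigma> (Osp H_zero) = kron (\<rho> (Osp H_zero)) (mat 1) + kron (mat 1) (\<sigma> (Osp H_zero))"
| "tensor_rep \<rho> \<sigma> (Osp F_plus) = kron (\<rho> (Osp F_plus)) (\<sigma> R_inv) + kron (mat 1) (\<sigma> (Osp F_plus))"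
| "tensor_rep \<rho> \<sigma> (Osp F_minus) = kron (\<rho> (Osp F_minus)) (\<sigma> R_inv) + kron (mat 1) (\<sigma> (Osp F_minus))"
| "tensor_rep \<rho> \<sigma> R_inv = kron (\<rho> R_inv) (\<sigma> R_inv)"

definition fund_Fp :: "3 cmat" where
  "fund_Fp = smat (1/2) (vector [vector [0, 0, 1], vector [0, 0, 0], vector [0, 1, 0]])"

definition fund_Fm :: "3 cmat" where
  "fund_Fm = smat (1/2) (vector [vector [0, 0, 0], vector [0, 0, -1], vector [1, 0, 0]])"

fun fund_rep :: "uosp_gen \<Rightarrow> 3 cmat" where
  "fund_rep (Osp H_zero) = smat (1/2) (vector [vector [1, 0, 0], vector [0, -1, 0], vector [0, 0, 0]])"
| "fund_rep (Osp F_plus) = fund_Fp"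
| "fund_rep (Osp F_minus) = fund_Fm"
| "fund_rep (Osp E_plus) = smat 4 (fund_Fp ** fund_Fp)"
| "fund_rep (Osp E_minus) = smat (- 4) (fund_Fm ** fund_Fm)"
| "fund_rep R_inv = vector [vector [1, 0, 0], vector [0, 1, 0], vector [0, 0, -1]]"

definition V_rep :: "uosp_gen \<Rightarrow> ((3 \<times> 3) \<times> 3) cmat" where
  "V_rep = tensor_rep (tensor_rep fund_rep fund_rep) fund_rep"

definition osp_centralizer :: "(uosp_gen \<Rightarrow> 'n::finite cmat) \<Rightarrow> (complex, 'n cmat) module" where
  "osp_centralizer \<rho> =
    \<lparr>carrier = {M. \<forall>g v. M *v (osp_act \<rho> g *v v) = osp_act \<rho> g *v (M *v v)},
     mult = (**), one = mat 1, zero = 0, add = (+), smult = smat\<rparr>"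


subsection \<open>The relations hold\<close>

lemma fund_osp_rep: "osp_rep fund_rep"
  unfolding osp_rep_def Let_def comm_mat_def anticomm_mat_def
  by (simp add: vec_eq_iff forall_3 smat_def fund_Fp_def fund_Fm_def matrix_matrix_mult_def sum_3 mat_def)

lemma matrix_add_rdistr: "(A + B) ** C = A ** C + B ** C" for A B C :: "'n::finite cmat"
  by (simp add: vec_eq_iff matrix_matrix_mult_def sum.distrib distrib_right)

lemma kron_mult: "kron A B ** kron C D = kron (A ** C) (B ** D)"
  by (simp add: vec_eq_iff kron_def matrix_matrix_mult_def sum_product sum.cartesian_product
      case_prod_beta ac_simps)

lemma kron_simps:
  "kron (A + A') B = kron A B + kron A' B" "kron A (B + B') = kron A B + kron A B'"
  "kron (A - A') B = kron A B - kron A' B" "kron A (B - B') = kron A B - kron A B'"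
  "kron (- A) B = - kron A B" "kron A (- B) = - kron A B"
  "kron (smat c A) B = smat c (kron A B)" "kron A (smat c B) = smat c (kron A B)"
  "kron 0 B = 0" "kron A 0 = 0"
  by (simp_all add: vec_eq_iff kron_def smat_def algebra_simps)

lemma kron_one: "kron (mat 1) (mat 1) = mat 1"
  by (auto simp: vec_eq_iff kron_def mat_def prod_eq_iff)

lemma smat_add: "smat c (A + B) = smat c A + smat c B"
  by (simp add: vec_eq_iff smat_def algebra_simps)

lemma comm_kron_prim:
  "comm_mat (kron A (mat 1) + kron (mat 1) B) (kron C (mat 1) + kron (mat 1) D)
    = kron (comm_mat A C) (mat 1) + kron (mat 1) (comm_mat B D)"
  by (simp add: comm_mat_def matrix_add_ldistrib matrix_add_rdistr kron_mult kron_simps)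

lemma comm_kron_mixed:
  "comm_mat B R = 0 \<Longrightarrow>
    comm_mat (kron A (mat 1) + kron (mat 1) B) (kron C R + kron (mat 1) D)
    = kron (comm_mat A C) R + kron (mat 1) (comm_mat B D)"
  by (simp add: comm_mat_def matrix_add_ldistrib matrix_add_rdistr kron_mult kron_simps)

lemma anticomm_kron:
  "\<lbrakk>R ** R = mat 1; anticomm_mat R B = 0; anticomm_mat R D = 0\<rbrakk> \<Longrightarrow>
    anticomm_mat (kron A R + kron (mat 1) B) (kron C R + kron (mat 1) D)
    = kron (anticomm_mat A C) (mat 1) + kron (mat 1) (anticomm_mat B D)"
  by (simp add: anticomm_mat_def matrix_add_ldistrib matrix_add_rdistr kron_mult
      add_eq_0_iff kron_simps)

lemma R_comm_kron:
  "\<lbrakk>comm_mat R A = 0; comm_mat S B = 0\<rbrakk> \<Longrightarrow>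
    comm_mat (kron R S) (kron A (mat 1) + kron (mat 1) B) = 0"
  by (simp add: comm_mat_def matrix_add_ldistrib matrix_add_rdistr kron_mult)

lemma R_anticomm_kron:
  "\<lbrakk>anticomm_mat R A = 0; anticomm_mat S B = 0\<rbrakk> \<Longrightarrow>
    anticomm_mat (kron R S) (kron A S + kron (mat 1) B) = 0"
  by (simp add: anticomm_mat_def matrix_add_ldistrib matrix_add_rdistr kron_mult
      add_eq_0_iff kron_simps)

text \<open>Compatibility of the coproduct with the defining relations.\<close>

lemma tensor_osp_rep:
  assumes "osp_rep \<rho>" "osp_rep \<sigma>"
  shows "osp_rep (tensor_rep \<rho> \<sigma>)"
proof -
  have c: "comm_mat (\<sigma> (Osp E_plus)) (\<sigma> R_inv) = 0" "comm_mat (\<sigma> (Osp E_minus)) (\<sigma> R_inv) = 0"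
    "comm_mat (\<sigma> (Osp H_zero)) (\<sigma> R_inv) = 0"
    using assms(2) by (simp_all add: osp_rep_def Let_def comm_mat_def)
  note rels = assms[unfolded osp_rep_def Let_def]
  show ?thesis
    unfolding osp_rep_def Let_def tensor_rep.simps
    by (intro conjI)
      (simp_all add: rels c comm_kron_prim comm_kron_mixed anticomm_kron kron_simps smat_add
        R_comm_kron R_anticomm_kron kron_mult kron_one)
qed

lemma V_osp_rep: "osp_rep V_rep"
  unfolding V_rep_def by (intro tensor_osp_rep fund_osp_rep)

lemma smat_mult: "smat c A ** B = smat c (A ** B)" "A ** smat c B = smat c (A ** B)"
  by (simp_all add: vec_eq_iff smat_def matrix_matrix_mult_def sum_distrib_left ac_simps)

lemma centralizer_iff:
  "M \<in> carrier (osp_centralizer \<rho>) \<longleftrightarrow> (\<forall>g. M ** osp_act \<rho> g = osp_act \<rho> g ** M)"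
  by (simp add: osp_centralizer_def matrix_vector_mul_assoc) (metis matrix_eq)

lemma calgebra_osp_centralizer: "calgebra (osp_centralizer \<rho>)"
proof -
  let ?C = "osp_centralizer \<rho>"
  have neg: "A ** (- B) = - (A ** B)" "(- A) ** B = - (A ** B)" for A B :: "'a cmat"
    by (simp_all add: vec_eq_iff matrix_matrix_mult_def sum_negf)
  have ops: "x \<otimes>\<^bsub>?C\<^esub> y = x ** y" "x \<oplus>\<^bsub>?C\<^esub> y = x + y" "\<one>\<^bsub>?C\<^esub> = mat 1" "\<zero>\<^bsub>?C\<^esub> = 0"
    "c \<odot>\<^bsub>?C\<^esub> x = smat c x" for x y c
    by (simp_all add: osp_centralizer_def)
  have dist: "A ** (B + C) = A ** B + A ** C" "(A + B) ** C = A ** C + B ** C" for A B C :: "'a cmat"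
    by (simp_all add: matrix_add_ldistrib matrix_add_rdistr)
  have "ring ?C"
  proof (rule ringI)
    show "abelian_group ?C"
    proof (rule abelian_groupI)
      fix x assume "x \<in> carrier ?C"
      then show "\<exists>y\<in>carrier ?C. y \<oplus>\<^bsub>?C\<^esub> x = \<zero>\<^bsub>?C\<^esub>"
        by (intro bexI[of _ "- x"]) (auto simp: ops centralizer_iff neg)
    qed (auto simp: ops centralizer_iff dist ac_simps)
    show "Group.monoid ?C"
      by (rule monoidI) (auto simp: ops centralizer_iff matrix_mul_assoc; metis matrix_mul_assoc)+
  qed (auto simp: ops dist)
  then interpret ring ?C .
  show ?thesis
    by unfold_locales
      (auto simp: ops centralizer_iff smat_mult smat_add, auto simp: vec_eq_iff smat_def algebra_simps)
qed

end

theory Submission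
  imports Defs
begin

text \<open>For every representation, \<open>(8 [F\<^sup>+, F\<^sup>-] + 1) R\<close> commutes with \<open>osp(1|2)\<close>. Applied to the first
  two factors, the last two factors and all three factors of \<open>\<V>\<close>, it yields the images of \<open>X\<close>, \<open>Y\<close> and
  \<open>\<omega>\<close>. Each irreducible constituent of \<open>\<V>\<close> has a one-dimensional weight space of weight zero, so that
  an element of the centralizer is determined by its restriction to the seven-dimensional zero weight
  space, where it preserves the eigenspaces of \<open>\<omega>\<close>; these have the dimensions 1, 2, 3, 1.

  In the quotiented Bannai--Ito algebra, the polynomials in \<open>X\<close> and \<open>\<omega>\<close> contain seven orthogonal
  idempotents \<open>P\<^sub>i\<close> with sum 1. Sandwiching \<open>X{X,Y} + {X,Y}X = 2X\<^sup>2 + 2{X,Y} + 2\<omega>X\<close>, the analogous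
  relation for \<open>Y\<close> and the cubic relations for \<open>Y\<close> and \<open>Z\<close> between them determines all products of the
  elements \<open>P\<^sub>i Y P\<^sub>j\<close>. Hence the algebra is spanned by 1 + 4 + 9 + 1 matrix units, and these act on an
  eigenbasis of the zero weight space as the elementary matrices of the blocks.\<close>

section \<open>Homomorphisms of quotient algebras\<close>

definition calg_hom :: "(complex, 'a) module \<Rightarrow> (complex, 'b) module \<Rightarrow> ('a \<Rightarrow> 'b) set" where
  "calg_hom A B =
    {\<phi> \<in> ring_hom A B. \<forall>c. \<forall>x \<in> carrier A. \<phi> (c \<odot>\<^bsub>A\<^esub> x) = c \<odot>\<^bsub>B\<^esub> \<phi> x}"

context calgebra
begin

lemma calg_proj_hom:
  assumes "S \<subseteq> carrier A"
  shows "calg_proj A S \<in> calg_hom A (calg_quot A S)"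
proof -
  interpret I: ideal "Idl S" A by (rule genideal_ideal[OF assms])
  show ?thesis
    unfolding calg_hom_def
  proof (intro CollectI conjI allI ballI ring_hom_memI)
    fix x y assume "x \<in> carrier A" "y \<in> carrier A"
    then show "calg_proj A S (x \<otimes> y) = calg_proj A S x \<otimes>\<^bsub>calg_quot A S\<^esub> calg_proj A S y"
      "calg_proj A S (x \<oplus> y) = calg_proj A S x \<oplus>\<^bsub>calg_quot A S\<^esub> calg_proj A S y"
      by (simp_all add: calg_quot_simps FactRing_simps calg_proj_def I.a_rcos_sum I.rcoset_mult_add)
  next
    show "calg_proj A S \<one> = \<one>\<^bsub>calg_quot A S\<^esub>"
      by (simp add: calg_quot_simps FactRing_simps calg_proj_def)
  qed (simp_all add: carrier_calg_quot calg_quot_smult[OF assms])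
qed

lemma calg_proj_eq_zero:
  assumes "S \<subseteq> carrier A" "x \<in> S"
  shows "calg_proj A S x = \<zero>\<^bsub>calg_quot A S\<^esub>"
proof -
  interpret I: ideal "Idl S" A by (rule genideal_ideal[OF assms(1)])
  have "x \<in> Idl S" using genideal_self[OF assms(1)] assms(2) by blast
  then show ?thesis
    by (simp add: calg_proj_def calg_quot_simps FactRing_def I.a_rcos_const)
qed

text \<open>The universal property of the quotient: the kernel of \<open>\<phi>\<close> is a
  two-sided ideal that contains \<open>S\<close>, hence it contains the ideal generated by
  \<open>S\<close>, and \<open>\<phi>\<close> is constant on cosets.\<close>

lemma calg_quot_induced_hom:
  assumes "calgebra B" "S \<subseteq> carrier A" "\<phi> \<in> calg_hom A B" "\<And>x. x \<in> S \<Longrightarrow> \<phi> x = \<zero>\<^bsub>B\<^esub>"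
  obtains \<psi> where "\<psi> \<in> calg_hom (calg_quot A S) B"
    and "\<And>x. x \<in> carrier A \<Longrightarrow> \<psi> (calg_proj A S x) = \<phi> x"
proof -
  interpret B: calgebra B by fact
  interpret I: ideal "Idl S" A by (rule genideal_ideal[OF assms(2)])
  have \<phi>: "\<phi> \<in> ring_hom A B" using assms(3) by (simp add: calg_hom_def)
  have h: "ring_hom_ring A B \<phi>"
    by (rule ring_hom_ringI2[OF ring_axioms B.ring_axioms \<phi>])
  have "S \<subseteq> a_kernel A B \<phi>"
    using assms(2,4) by (auto simp: a_kernel_def')
  then have ker: "Idl S \<subseteq> a_kernel A B \<phi>"
    by (rule genideal_minimal[OF ring_hom_ring.kernel_is_ideal[OF h]])
  \<comment> \<open>The image of a coset under \<open>\<phi>\<close> will turn out to be a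
    singleton, so no choice of representatives is made.\<close>
  define \<psi> where "\<psi> C = the_elem (\<phi> ` C)" for C
  have \<psi>: "\<psi> (calg_proj A S x) = \<phi> x" if x: "x \<in> carrier A" for x
  proof -
    have i: "\<phi> (i \<oplus> x) = \<phi> x" if "i \<in> Idl S" for i
    proof -
      have "i \<in> carrier A" "\<phi> i = \<zero>\<^bsub>B\<^esub>" using that ker by (auto simp: a_kernel_def')
      then show ?thesis using x ring_hom_add[OF \<phi>] ring_hom_closed[OF \<phi>] by simp
    qed
    have "\<phi> z = \<phi> x" if "z \<in> calg_proj A S x" for z
      using that i by (auto simp: calg_proj_def a_r_coset_def')
    moreover have "x \<in> calg_proj A S x"
      unfolding calg_proj_def by (rule I.a_rcos_self[OF x])
    ultimately have "\<phi> ` calg_proj A S x = {\<phi> x}" by blast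
    then show ?thesis by (simp add: \<psi>_def)
  qed
  have p: "calg_proj A S \<in> calg_hom A (calg_quot A S)" by (rule calg_proj_hom[OF assms(2)])
  have p': "calg_proj A S (x \<otimes> y) = calg_proj A S x \<otimes>\<^bsub>calg_quot A S\<^esub> calg_proj A S y"
    "calg_proj A S (x \<oplus> y) = calg_proj A S x \<oplus>\<^bsub>calg_quot A S\<^esub> calg_proj A S y"
    "calg_proj A S (c \<odot> x) = c \<odot>\<^bsub>calg_quot A S\<^esub> calg_proj A S x"
    "calg_proj A S \<one> = \<one>\<^bsub>calg_quot A S\<^esub>"
    if "x \<in> carrier A" "y \<in> carrier A" for x y c
    using that p by (auto simp: calg_hom_def ring_hom_add ring_hom_mult ring_hom_one)
  have f: "\<phi> (c \<odot> x) = c \<odot>\<^bsub>B\<^esub> \<phi> x" if "x \<in> carrier A" for x c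
    using that assms(3) by (simp add: calg_hom_def)
  have "\<psi> \<in> calg_hom (calg_quot A S) B"
    unfolding calg_hom_def
  proof (intro CollectI conjI allI ballI ring_hom_memI)
    show "\<psi> \<one>\<^bsub>calg_quot A S\<^esub> = \<one>\<^bsub>B\<^esub>"
      using \<psi>[OF one_closed] p'(4)[OF one_closed one_closed] ring_hom_one[OF \<phi>] by simp
  next
    fix C assume C: "C \<in> carrier (calg_quot A S)"
    then obtain x where x: "x \<in> carrier A" "C = calg_proj A S x" by (auto simp: carrier_calg_quot)
    then show "\<psi> C \<in> carrier B" by (simp add: \<psi> ring_hom_closed[OF \<phi>])
    show "\<psi> (c \<odot>\<^bsub>calg_quot A S\<^esub> C) = c \<odot>\<^bsub>B\<^esub> \<psi> C" for c
      using x by (simp add: \<psi> f flip: p'(3))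
    fix D assume D: "D \<in> carrier (calg_quot A S)"
    then obtain y where y: "y \<in> carrier A" "D = calg_proj A S y" by (auto simp: carrier_calg_quot)
    show "\<psi> (C \<otimes>\<^bsub>calg_quot A S\<^esub> D) = \<psi> C \<otimes>\<^bsub>B\<^esub> \<psi> D" "\<psi> (C \<oplus>\<^bsub>calg_quot A S\<^esub> D) = \<psi> C \<oplus>\<^bsub>B\<^esub> \<psi> D"
      using x y by (simp_all add: \<psi> ring_hom_add[OF \<phi>] ring_hom_mult[OF \<phi>] flip: p'(1,2))
  qed
  then show thesis using \<psi> by (rule that)
qed

end

section \<open>Centralizers and the tensor product\<close>

lemma smat_smat: "smat a (smat b M) = smat (a * b) M"
  and smat_add_left: "smat (a + b) M = smat a M + smat b M"
  and smat_1: "smat 1 M = M" and smat_0: "smat 0 M = 0" "smat a 0 = 0"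
  by (simp_all add: vec_eq_iff smat_def algebra_simps)

lemma smat_diff: "smat c (A - B) = smat c A - smat c B" "smat c (- A) = - smat c A"
  by (simp_all add: vec_eq_iff smat_def algebra_simps)

lemma matrix_mult_diff:
  fixes A B C :: "'n::finite cmat"
  shows "A ** (B - C) = A ** B - A ** C" "(A - B) ** C = A ** C - B ** C"
    "A ** (- B) = - (A ** B)" "(- A) ** B = - (A ** B)" "A ** 0 = 0" "0 ** A = 0"
  by (simp_all add: vec_eq_iff matrix_matrix_mult_def sum_subtractf algebra_simps sum_negf)

lemma matrix_sum_mult:
  fixes A :: "'n::finite cmat"
  shows "A ** (\<Sum>i\<in>I. B i) = (\<Sum>i\<in>I. A ** B i)" "(\<Sum>i\<in>I. B i) ** A = (\<Sum>i\<in>I. B i ** A)"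
  by (induction I rule: infinite_finite_induct)
    (simp_all add: matrix_mult_diff matrix_add_ldistrib matrix_add_rdistr)

lemmas matrix_expand = matrix_mult_diff matrix_add_ldistrib matrix_add_rdistr smat_mult smat_smat
    smat_add
  smat_diff smat_1 matrix_mul_assoc

section \<open>Generation by the odd elements\<close>

lemma osp_act_basis: "osp_act \<rho> (\<lambda>b. if b = a then 1 else 0) = \<rho> (Osp a)"
proof -
  have "osp_act \<rho> (\<lambda>b. if b = a then 1 else 0) = (\<Sum>b\<in>UNIV. if b = a then \<rho> (Osp a) else 0)"
    unfolding osp_act_def by (rule sum.cong) (auto simp: smat_1 smat_0)
  then show ?thesis by simp
qed

lemma centralizer_iff_basis:
  "M \<in> carrier (osp_centralizer \<rho>) \<longleftrightarrow> (\<forall>b. M ** \<rho> (Osp b) = \<rho> (Osp b) ** M)"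
proof
  assume "M \<in> carrier (osp_centralizer \<rho>)"
  then show "\<forall>b. M ** \<rho> (Osp b) = \<rho> (Osp b) ** M"
    unfolding centralizer_iff by (metis osp_act_basis)
next
  assume "\<forall>b. M ** \<rho> (Osp b) = \<rho> (Osp b) ** M"
  then show "M \<in> carrier (osp_centralizer \<rho>)"
    by (simp add: centralizer_iff osp_act_def matrix_sum_mult smat_mult)
qed

text \<open>The anticommutators of the odd generators exhaust the even part. Membership in the
  centralizer therefore reduces to commutation with two matrices.\<close>

lemma osp_rep_odd_generate:
  assumes "osp_rep \<rho>"
  defines "Fp \<equiv> \<rho> (Osp F_plus)" and "Fm \<equiv> \<rho> (Osp F_minus)"
  shows "\<rho> (Osp E_plus) = smat 4 (Fp ** Fp)" "\<rho> (Osp E_minus) = smat (- 4) (Fm ** Fm)"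
    "\<rho> (Osp H_zero) = smat 2 (Fp ** Fm + Fm ** Fp)"
proof -
  have r: "smat (1/2) (\<rho> (Osp E_plus)) = Fp ** Fp + Fp ** Fp"
      "smat (- 1/2) (\<rho> (Osp E_minus)) = Fm ** Fm + Fm ** Fm"
    "smat (1/2) (\<rho> (Osp H_zero)) = Fp ** Fm + Fm ** Fp"
    using assms by (simp_all add: osp_rep_def Let_def anticomm_mat_def)
  have "smat 2 (smat (1/2) (\<rho> (Osp E_plus))) = smat 4 (Fp ** Fp)"
    unfolding r by (simp add: vec_eq_iff smat_def)
  then show "\<rho> (Osp E_plus) = smat 4 (Fp ** Fp)" by (simp add: smat_smat smat_1)
  have "smat (- 2) (smat (- 1/2) (\<rho> (Osp E_minus))) = smat (- 4) (Fm ** Fm)"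
    unfolding r by (simp add: vec_eq_iff smat_def)
  then show "\<rho> (Osp E_minus) = smat (- 4) (Fm ** Fm)" by (simp add: smat_smat smat_1)
  have "smat 2 (smat (1/2) (\<rho> (Osp H_zero))) = smat 2 (Fp ** Fm + Fm ** Fp)"
    unfolding r by simp
  then show "\<rho> (Osp H_zero) = smat 2 (Fp ** Fm + Fm ** Fp)" by (simp add: smat_smat smat_1)
qed

lemma centralizer_iff_odd:
  assumes "osp_rep \<rho>"
  shows "M \<in> carrier (osp_centralizer \<rho>) \<longleftrightarrow>
    M ** \<rho> (Osp F_plus) = \<rho> (Osp F_plus) ** M \<and> M ** \<rho> (Osp F_minus) = \<rho> (Osp F_minus) ** M"
    (is "_ \<longleftrightarrow> ?R")
proof
  assume R: ?R
  have *: "M ** (A ** B) = (A ** B) ** M" if "M ** A = A ** M" "M ** B = B ** M" for A B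
    by (metis matrix_mul_assoc that)
  have "M ** \<rho> (Osp b) = \<rho> (Osp b) ** M" for b
    by (cases b) (simp_all add: osp_rep_odd_generate[OF assms] smat_mult matrix_add_ldistrib
        matrix_add_rdistr * R)
  then show "M \<in> carrier (osp_centralizer \<rho>)" by (simp add: centralizer_iff_basis)
qed (simp add: centralizer_iff_basis)

section \<open>The sCasimir element and its product with the grading involution\<close>

definition scasimir :: "(uosp_gen \<Rightarrow> 'n::finite cmat) \<Rightarrow> 'n cmat" where
  "scasimir \<rho> = smat 8 (comm_mat (\<rho> (Osp F_plus)) (\<rho> (Osp F_minus))) + mat 1"

definition grade_casimir :: "(uosp_gen \<Rightarrow> 'n::finite cmat) \<Rightarrow> 'n cmat" where
  "grade_casimir \<rho> = scasimir \<rho> ** \<rho> R_inv"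

text \<open>This is the sCasimir property. In S F+ + F+ S with S = 8 [F+, F-] + 1 the terms F+ F- F+
  cancel, leaving 8 [F+ F+, F-] + 2 F+. This vanishes, since E+ = 4 F+ F+ and [E+, F-] = - F+. The
  case of F- is analogous.\<close>

lemma scasimir_anticommute:
  assumes "osp_rep \<rho>"
  shows "scasimir \<rho> ** \<rho> (Osp F_plus) = - (\<rho> (Osp F_plus) ** scasimir \<rho>)"
    "scasimir \<rho> ** \<rho> (Osp F_minus) = - (\<rho> (Osp F_minus) ** scasimir \<rho>)"
proof -
  define Fp Fm where F: "Fp = \<rho> (Osp F_plus)" "Fm = \<rho> (Osp F_minus)"
  have c: "smat 4 (Fp ** Fp ** Fm) - smat 4 (Fm ** Fp ** Fp) = - Fp"
    "- smat 4 (Fm ** Fm ** Fp) + smat 4 (Fp ** Fm ** Fm) = - Fm"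
    using assms osp_rep_odd_generate[OF assms]
    by (simp_all add: osp_rep_def Let_def comm_mat_def F matrix_expand)
       (simp_all add: vec_eq_iff smat_def matrix_matrix_mult_def)
  show "scasimir \<rho> ** \<rho> (Osp F_plus) = - (\<rho> (Osp F_plus) ** scasimir \<rho>)"
    using arg_cong[OF c(1), of "smat 2"]
    by (simp add: scasimir_def comm_mat_def matrix_expand flip: F)
      (simp add: vec_eq_iff smat_def algebra_simps)
  show "scasimir \<rho> ** \<rho> (Osp F_minus) = - (\<rho> (Osp F_minus) ** scasimir \<rho>)"
    using arg_cong[OF c(2), of "smat 2"]
    by (simp add: scasimir_def comm_mat_def matrix_expand flip: F)
      (simp add: vec_eq_iff smat_def algebra_simps)
qed

lemma R_anticommute:
  assumes "osp_rep \<rho>"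
  shows "\<rho> R_inv ** \<rho> (Osp F_plus) = - (\<rho> (Osp F_plus) ** \<rho> R_inv)"
    "\<rho> R_inv ** \<rho> (Osp F_minus) = - (\<rho> (Osp F_minus) ** \<rho> R_inv)"
  using assms by (simp_all add: osp_rep_def Let_def anticomm_mat_def add_eq_0_iff2)

lemma anticommute_mult:
  fixes A B C :: "'n::finite cmat"
  assumes "A ** C = - (C ** A)" "B ** C = - (C ** B)"
  shows "(A ** B) ** C = C ** (A ** B)"
proof -
  have "(A ** B) ** C = A ** (B ** C)" by (simp add: matrix_mul_assoc)
  also have "\<dots> = - ((A ** C) ** B)" by (simp add: assms matrix_mult_diff matrix_mul_assoc)
  also have "\<dots> = C ** (A ** B)" by (simp add: assms matrix_mult_diff matrix_mul_assoc)
  finally show ?thesis .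
qed

lemma grade_casimir_centralizer:
  assumes "osp_rep \<rho>"
  shows "grade_casimir \<rho> \<in> carrier (osp_centralizer \<rho>)"
  unfolding centralizer_iff_odd[OF assms] grade_casimir_def
  by (intro conjI anticommute_mult scasimir_anticommute R_anticommute assms)

text \<open>The bracket [F+, F-] consists of products of two odd elements, so it is even. The
  property is what permits the operator to act on the right-hand factor of a tensor product.\<close>

lemma grade_casimir_R:
  assumes "osp_rep \<rho>"
  shows "grade_casimir \<rho> ** \<rho> R_inv = \<rho> R_inv ** grade_casimir \<rho>"
proof -
  let ?R = "\<rho> R_inv" and ?Fp = "\<rho> (Osp F_plus)" and ?Fm = "\<rho> (Osp F_minus)"
  have r: "?Fp ** ?R = - (?R ** ?Fp)" "?Fm ** ?R = - (?R ** ?Fm)"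
    using R_anticommute[OF assms] by simp_all
  have "(?Fp ** ?Fm) ** ?R = ?R ** (?Fp ** ?Fm)" "(?Fm ** ?Fp) ** ?R = ?R ** (?Fm ** ?Fp)"
    by (intro anticommute_mult r)+
  then have "scasimir \<rho> ** ?R = ?R ** scasimir \<rho>"
    by (simp add: scasimir_def comm_mat_def matrix_mult_diff matrix_add_ldistrib matrix_add_rdistr
        smat_mult)
  then show ?thesis by (metis grade_casimir_def matrix_mul_assoc)
qed

section \<open>Centralizer elements acting on some of the tensor factors\<close>

lemma kron_centralizer_left:
  assumes "osp_rep \<rho>" "osp_rep \<sigma>" "M \<in> carrier (osp_centralizer \<rho>)"
  shows "kron M (mat 1) \<in> carrier (osp_centralizer (tensor_rep \<rho> \<sigma>))"
  using assms(3) unfolding centralizer_iff_odd[OF assms(1)] centralizer_iff_odd[OF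
      tensor_osp_rep[OF assms(1,2)]]
  by (simp add: matrix_add_ldistrib matrix_add_rdistr kron_mult)

text \<open>The coproduct puts R on the right of F in \<open>F \<otimes> R\<close>, so in contrast
  to the left factor the operator has to commute with R as well.\<close>

lemma kron_centralizer_right:
  assumes "osp_rep \<rho>" "osp_rep \<sigma>" "M \<in> carrier (osp_centralizer \<sigma>)" "M ** \<sigma> R_inv = \<sigma> R_inv ** M"
  shows "kron (mat 1) M \<in> carrier (osp_centralizer (tensor_rep \<rho> \<sigma>))"
  using assms(3,4) unfolding centralizer_iff_odd[OF assms(2)] centralizer_iff_odd[OF
      tensor_osp_rep[OF assms(1,2)]]
  by (simp add: matrix_add_ldistrib matrix_add_rdistr kron_mult)

text \<open>An operator on the last two factors naturally lives on indices bracketed to the right,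
  whereas \<open>V_rep\<close> is bracketed to the left; this transports matrices between the two
  index types.\<close>

definition reassoc :: "('a::finite \<times> 'b::finite \<times> 'c::finite) cmat \<Rightarrow> (('a \<times> 'b) \<times> 'c) cmat" where
  "reassoc A = (\<chi> i j. A $ (fst (fst i), snd (fst i), snd i) $ (fst (fst j), snd (fst j), snd j))"

lemma sum_UNIV_reassoc:
  "(\<Sum>i\<in>(UNIV :: (('a::finite \<times> 'b::finite) \<times> 'c::finite) set). f (fst (fst i), snd (fst i), snd i))
      = sum f UNIV"
  by (rule sum.reindex_bij_witness[of _ "\<lambda>(a, b, c). ((a, b), c)"
      "\<lambda>i. (fst (fst i), snd (fst i), snd i)"]) auto

lemma reassoc_mult: "reassoc A ** reassoc B = reassoc (A ** B)"
proof -
  have "(\<Sum>k\<in>UNIV. reassoc A $ i $ k * reassoc B $ k $ j) = reassoc (A ** B) $ i $ j" for i j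
    unfolding reassoc_def matrix_matrix_mult_def vec_lambda_beta
    by (rule sum_UNIV_reassoc)
  then show ?thesis by (simp add: vec_eq_iff matrix_matrix_mult_def)
qed

lemma reassoc_add: "reassoc (A + B) = reassoc A + reassoc B"
  by (simp add: vec_eq_iff reassoc_def)

lemma reassoc_kron: "reassoc (kron A (kron B C)) = kron (kron A B) C"
  by (simp add: vec_eq_iff reassoc_def kron_def)

text \<open>Coassociativity of the coproduct: for the odd generators both bracketings give \<open>F
  \<otimes> R \<otimes> R + 1 \<otimes> F \<otimes> R + 1 \<otimes> 1 \<otimes> F\<close>.\<close>

lemma tensor_rep_assoc:
  "tensor_rep (tensor_rep \<rho> \<sigma>) \<tau> g = reassoc (tensor_rep \<rho> (tensor_rep \<sigma> \<tau>) g)"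
proof (cases g)
  case (Osp b)
  then show ?thesis by (cases b) (simp_all add: reassoc_add kron_simps reassoc_kron
      kron_one[symmetric] add.assoc)
qed (simp add: reassoc_kron)

lemma reassoc_centralizer:
  assumes "M \<in> carrier (osp_centralizer (tensor_rep \<rho> (tensor_rep \<sigma> \<tau>)))"
  shows "reassoc M \<in> carrier (osp_centralizer (tensor_rep (tensor_rep \<rho> \<sigma>) \<tau>))"
  using assms by (simp add: centralizer_iff_basis tensor_rep_assoc reassoc_mult)

section \<open>Evaluation of free algebras\<close>

primrec eval_word :: "('g \<Rightarrow> 'n::finite cmat) \<Rightarrow> 'g list \<Rightarrow> 'n cmat" where
  "eval_word \<rho> [] = mat 1"
| "eval_word \<rho> (g # u) = \<rho> g ** eval_word \<rho> u"

lemma eval_word_append: "eval_word \<rho> (u @ v) = eval_word \<rho> u ** eval_word \<rho> v"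
  by (induction u) (simp_all add: matrix_mul_assoc)

definition eval_falg :: "('g \<Rightarrow> 'n::finite cmat) \<Rightarrow> 'g falg \<Rightarrow> 'n cmat" where
  "eval_falg \<rho> p = (\<Sum>m\<in>Poly_Mapping.keys p. smat (Poly_Mapping.lookup p m) (case m of Word u \<Rightarrow>
      eval_word \<rho> u))"

lemma eval_falg_superset:
  "finite K \<Longrightarrow> Poly_Mapping.keys p \<subseteq> K \<Longrightarrow>
    eval_falg \<rho> p = (\<Sum>m\<in>K. smat (Poly_Mapping.lookup p m) (case m of Word u \<Rightarrow> eval_word \<rho> u))"
  unfolding eval_falg_def by (rule sum.mono_neutral_left) (auto simp: in_keys_iff smat_0)

lemma eval_falg_add: "eval_falg \<rho> (p + q) = eval_falg \<rho> p + eval_falg \<rho> q"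
proof -
  let ?K = "Poly_Mapping.keys p \<union> Poly_Mapping.keys q"
  show ?thesis
    using Poly_Mapping.keys_add[of p q]
    by (simp add: eval_falg_superset[of ?K] lookup_add smat_add_left sum.distrib)
qed

lemma eval_falg_single: "eval_falg \<rho> (Poly_Mapping.single (Word u) c) = smat c (eval_word \<rho> u)"
  by (simp add: eval_falg_superset[of "{Word u}"])

text \<open>The sum step carries no condition on the supports, which suits maps that are known to be
  additive.\<close>

lemma falg_induct [case_names single add]:
  assumes "\<And>u c. Q (Poly_Mapping.single (Word u) c)" "\<And>p q. Q p \<Longrightarrow> Q q \<Longrightarrow> Q (p + q)"
  shows "Q (p :: 'g falg)"
proof (induction p rule: update_induct)
  case const
  then show ?case using assms(1)[of _ 0] by simp
next
  case (update f a b)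
  have "Poly_Mapping.update a b f = f + Poly_Mapping.single a b"
    using update(1) by (intro poly_mapping_eqI) (auto simp: lookup_update lookup_add lookup_single
        in_keys_iff when_def)
  moreover have "Q (Poly_Mapping.single a b)" using assms(1) by (cases a) simp
  ultimately show ?case using assms(2) update by simp
qed

lemma eval_falg_mult: "eval_falg \<rho> (p * q) = eval_falg \<rho> p ** eval_falg \<rho> q"
proof (induction p rule: falg_induct)
  case (single u c)
  show ?case
    by (induction q rule: falg_induct)
       (simp_all add: distrib_left eval_falg_add matrix_add_ldistrib mult_single eval_falg_single
         smat_mult smat_smat eval_word_append mult.commute)
qed (simp add: distrib_right eval_falg_add matrix_add_rdistr)

lemma eval_falg_hom:
  fixes \<rho> :: "'g \<Rightarrow> 'n::finite cmat"
  shows "eval_falg \<rho> 0 = 0" "eval_falg \<rho> (- p) = - eval_falg \<rho> p"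
      "eval_falg \<rho> (p - q) = eval_falg \<rho> p - eval_falg \<rho> q"
    "eval_falg \<rho> 1 = mat 1" "eval_falg \<rho> (gen g) = \<rho> g"
        "eval_falg \<rho> (Poly_Mapping.single 0 c * p) = smat c (eval_falg \<rho> p)"
    "eval_falg \<rho> (numeral n) = smat (numeral n) (mat 1)"
proof -
  show 0: "eval_falg \<rho> 0 = 0" by (simp add: eval_falg_def)
  show neg: "eval_falg \<rho> (- p) = - eval_falg \<rho> p" for p
    using eval_falg_add[of \<rho> p "- p"] 0 by (simp add: add_eq_0_iff)
  show "eval_falg \<rho> (p - q) = eval_falg \<rho> p - eval_falg \<rho> q"
    using eval_falg_add[of \<rho> p "- q"] by (simp add: neg)
  have s: "eval_falg \<rho> (Poly_Mapping.single 0 c) = smat c (mat 1)" for c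
    by (simp add: zero_fmon_def eval_falg_single)
  show "eval_falg \<rho> 1 = mat 1" using s[of 1] by (simp add: smat_1)
  show "eval_falg \<rho> (gen g) = \<rho> g" by (simp add: gen_def eval_falg_single smat_1)
  show "eval_falg \<rho> (Poly_Mapping.single 0 c * p) = smat c (eval_falg \<rho> p)"
    by (simp add: eval_falg_mult s smat_mult)
  show "eval_falg \<rho> (numeral n) = smat (numeral n) (mat 1)"
    using s[of "numeral n"] by (simp add: single_numeral)
qed

section \<open>Matrix units in the quotiented Bannai--Ito algebra\<close>

text \<open>Reduces linear combinations of noncommuting monomials to linear arithmetic over the reals.\<close>

lemma real_linear_functional_eqI:
  fixes x y :: "'a::real_vector"
  assumes "\<And>f :: 'a \<Rightarrow> real. linear f \<Longrightarrow> f x = f y"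
  shows "x = y"
proof (rule ccontr)
  assume "x \<noteq> y"
  then have "independent {x - y}" by simp
  then obtain f :: "'a \<Rightarrow> real" where f: "linear f" "\<forall>v\<in>{x - y}. f v = 1"
    using linear_independent_extend[of "{x - y}" "\<lambda>_. 1"] by blast
  then show False using assms[OF f(1)] by (simp add: linear_diff)
qed

text \<open>Labels of the joint eigenvectors of \<open>\<omega>\<close> and \<open>X\<close> on the zero weight space. The letter stands for
  the eigenvalue of \<open>\<omega>\<close>; column \<open>j\<close> of \<open>Y_entry\<close> is the action of \<open>Y\<close> on the \<open>j\<close>-th vector.\<close>

datatype bi_ix = A1 | B1 | B2 | C1 | C2 | C3 | D1

lemma UNIV_bi_ix: "UNIV = {A1, B1, B2, C1, C2, C3, D1}"
  by (auto intro: bi_ix.exhaust)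

instance bi_ix :: finite
  by standard (simp add: UNIV_bi_ix)

lemma sum_bi_ix: "sum f UNIV = f A1 + f B1 + f B2 + f C1 + f C2 + f C3 + f D1"
  for f :: "bi_ix \<Rightarrow> 'a::comm_monoid_add"
  by (simp add: UNIV_bi_ix ac_simps)

fun omega_ev :: "bi_ix \<Rightarrow> real" where
  "omega_ev A1 = 14" | "omega_ev B1 = - 4" | "omega_ev B2 = - 4" | "omega_ev C1
      = 8" | "omega_ev C2 = 8" | "omega_ev C3 = 8" | "omega_ev D1 = 2"

fun X_ev :: "bi_ix \<Rightarrow> real" where
  "X_ev A1 = - 2" | "X_ev B1 = - 2" | "X_ev B2 = 2" | "X_ev C1 = - 2" | "X_ev C2 = 2" | "X_ev C3
      = 0" | "X_ev D1 = 2"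

fun Y_entry :: "bi_ix \<Rightarrow> bi_ix \<Rightarrow> real" where
  "Y_entry A1 A1 = - 2"
| "Y_entry B1 B1 = 1" | "Y_entry B1 B2 = - 1" | "Y_entry B2 B1 = - 3" | "Y_entry B2 B2 = - 1"
| "Y_entry C1 C1 = - 1" | "Y_entry C1 C2 = - 1" | "Y_entry C2 C1 = 1" | "Y_entry C2 C2
    = 5" | "Y_entry C2 C3 = 2"
| "Y_entry C3 C2 = - 8" | "Y_entry C3 C3 = - 4"
| "Y_entry D1 D1 = 2"
| "Y_entry _ _ = 0"

text \<open>Neither X nor omega separates the seven labels, but the pair does. This is the source of
  the orthogonality of the idempotents and of their action on the eigenbasis.\<close>

lemma joint_spectrum_inj: "X_ev i = X_ev j \<Longrightarrow> omega_ev i = omega_ev j \<Longrightarrow> i = j"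
  by (cases i; cases j) simp_all

text \<open>All eigenvalues and structure constants are real, so the computations take place in a
  real algebra. The variable \<open>w\<close> stands for the common value of the three central
  elements.\<close>

locale bannai_ito_relations =
  fixes X Y Z w :: "'a::real_algebra_1"
  assumes XY: "X * Y + Y * X = X + Y + Z + w"
    and XZ: "X * Z + Z * X = X + Y + Z + w"
    and YZ: "Y * Z + Z * Y = X + Y + Z + w"
    and wX: "w * X = X * w" and wY: "w * Y = Y * w"
    and X3: "X * (X * X) = 4 *\<^sub>R X" and Y3: "Y * (Y * Y) = 4 *\<^sub>R Y" and Z3: "Z * (Z * Z) = 4 *\<^sub>R Z"
    and w4: "(w + 4 *\<^sub>R 1) * (w - 2 *\<^sub>R 1) * (w - 8 *\<^sub>R 1) * (w - 14 *\<^sub>R 1) = 0"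
    and Xw: "(X - w + 16 *\<^sub>R 1) * (X - w + 10 *\<^sub>R 1) * (X - w + 8 *\<^sub>R 1) * (X - w + 6 *\<^sub>R 1)
      * (X - w) * (X - w - 2 *\<^sub>R 1) * (X - w - 6 *\<^sub>R 1) = 0"
begin

text \<open>Lagrange interpolation polynomials on the spectra of \<open>X\<close> and \<open>w\<close>.\<close>

definition pX :: "real \<Rightarrow> 'a" where
  "pX x = (if x = 2 then (1/8) *\<^sub>R (X * X + 2 *\<^sub>R X)
    else if x = - 2 then (1/8) *\<^sub>R (X * X - 2 *\<^sub>R X) else 1 - (1/4) *\<^sub>R (X * X))"

definition pw :: "real \<Rightarrow> 'a" where
  "pw c = (if c = 14 then (1/1296) *\<^sub>R ((w + 4 *\<^sub>R 1) * (w - 2 *\<^sub>R 1) * (w - 8 *\<^sub>R 1))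
    else if c = 8 then (- 1/432) *\<^sub>R ((w + 4 *\<^sub>R 1) * (w - 2 *\<^sub>R 1) * (w - 14 *\<^sub>R 1))
    else if c = 2 then (1/432) *\<^sub>R ((w + 4 *\<^sub>R 1) * (w - 8 *\<^sub>R 1) * (w - 14 *\<^sub>R 1))
    else (- 1/1296) *\<^sub>R ((w - 2 *\<^sub>R 1) * (w - 8 *\<^sub>R 1) * (w - 14 *\<^sub>R 1)))"

lemma X_pX: "x \<in> {2, - 2, 0} \<Longrightarrow> X * pX x = x *\<^sub>R pX x"
  using X3 by (auto simp: pX_def algebra_simps)

lemma pX_sum: "pX 2 + pX (- 2) + pX 0 = 1"
  by (rule real_linear_functional_eqI) (simp add: pX_def linear_add linear_diff linear_scale)

lemmas lin_simps = algebra_simps linear_add linear_diff linear_scale linear_neg linear_0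

lemma pw_sum: "pw 14 + pw 8 + pw 2 + pw (- 4) = 1"
  by (rule real_linear_functional_eqI) (simp add: pw_def lin_simps)

lemma w_pw: "c \<in> {14, 8, 2, - 4} \<Longrightarrow> w * pw c = c *\<^sub>R pw c"
proof -
  assume c: "c \<in> {14, 8, 2, - 4}"
  show ?thesis
  proof (rule real_linear_functional_eqI)
    fix f :: "'a \<Rightarrow> real"
    assume f: "linear f"
    have "f ((w + 4 *\<^sub>R 1) * (w - 2 *\<^sub>R 1) * (w - 8 *\<^sub>R 1) * (w - 14 *\<^sub>R 1)) = 0"
      using f by (simp add: w4 linear_0)
    then show "f (w * pw c) = f (c *\<^sub>R pw c)"
      using f c by (auto simp add: pw_def lin_simps)
  qed
qed

lemma pX_commute: "X * pX x = pX x * X"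
  by (simp add: pX_def algebra_simps)

lemma pw_X: "pw c * X = X * pw c" and pw_w: "pw c * w = w * pw c"
proof -
  have "w * (w * X) = X * (w * w)" "w * (w * (w * X)) = X * (w * (w * w))"
    by (simp_all add: wX flip: mult.assoc)
  then show "pw c * X = X * pw c" "pw c * w = w * pw c"
    by (simp_all add: pw_def algebra_simps wX)
qed

lemma wXX: "w * (X * X) = X * X * w"
  by (simp add: wX flip: mult.assoc) (simp add: wX mult.assoc)

lemma w_pX: "w * pX x = pX x * w"
  by (simp add: pX_def algebra_simps wX wXX)

section \<open>Joint spectral projections of w and X\<close>

definition P :: "bi_ix \<Rightarrow> 'a" where "P i = pw (omega_ev i) * pX (X_ev i)"

lemma X_pp: "x \<in> {2, - 2, 0} \<Longrightarrow> X * (pw c * pX x) = x *\<^sub>R (pw c * pX x)"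
proof -
  assume "x \<in> {2, - 2, 0}"
  then have "pw c * (X * pX x) = x *\<^sub>R (pw c * pX x)" by (simp add: X_pX)
  then show ?thesis by (simp add: pw_X flip: mult.assoc)
qed

lemma w_pp: "c \<in> {14, 8, 2, - 4} \<Longrightarrow> w * (pw c * pX x) = c *\<^sub>R (pw c * pX x)"
  using w_pw[of c] by (simp flip: mult.assoc)

text \<open>On a product of spectral projections X and w act as the scalars x and c, so the septic
  relation multiplies it by a number; if that number is nonzero, the product vanishes.\<close>

lemma pp_eq_0:
  assumes "c \<in> {14, 8, 2, - 4}" "x \<in> {2, - 2, 0}"
    and "(x - c + 16) * (x - c + 10) * (x - c + 8) * (x - c + 6) * (x - c) * (x - c - 2) * (x - c
        - 6) \<noteq> 0"
  shows "pw c * pX x = 0"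
proof -
  let ?v = "pw c * pX x"
  have [simp]: "(X - w) * ?v = (x - c) *\<^sub>R ?v" "(X - w + k *\<^sub>R 1) * ?v = (x - c + k) *\<^sub>R ?v"
    "(X - w - k *\<^sub>R 1) * ?v = (x - c - k) *\<^sub>R ?v" for k
    using X_pp[OF assms(2), of c] w_pp[OF assms(1), of x]
    by (simp_all add: algebra_simps)
  have "(X - w + 16 *\<^sub>R 1) * (X - w + 10 *\<^sub>R 1) * (X - w + 8 *\<^sub>R 1) * (X - w + 6 *\<^sub>R 1)
      * (X - w) * (X - w - 2 *\<^sub>R 1) * (X - w - 6 *\<^sub>R 1) * ?v = 0"
    by (simp only: Xw mult_zero_left)
  then have "((x - c + 16) * (x - c + 10) * (x - c + 8) * (x - c + 6) * (x - c) * (x - c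
      - 2) * (x - c - 6)) *\<^sub>R ?v = 0"
    by (simp add: mult.assoc del: scaleR_eq_0_iff mult_eq_0_iff) (simp add: mult_ac)
  then show ?thesis using assms(3) by (simp only: scaleR_eq_0_iff) blast
qed

lemma P_sum: "P A1 + P B1 + P B2 + P C1 + P C2 + P C3 + P D1 = 1"
proof -
  \<comment> \<open>Of the twelve pairs of eigenvalues these five drop out: x - c equals -12, -14,
    4, -4, -2, and none of these is among the roots -16, -10, -8, -6, 0, 2, 6 of the septic.\<close>
  have z: "pw 14 * pX 2 = 0" "pw 14 * pX 0 = 0" "pw (- 4) * pX 0 = 0" "pw 2 * pX (- 2) = 0"
      "pw 2 * pX 0 = 0"
    by (rule pp_eq_0; simp)+
  have "1 = (pw 14 + pw 8 + pw 2 + pw (- 4)) * (pX 2 + pX (- 2) + pX 0)"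
    by (simp only: pX_sum pw_sum mult_1)
  then show ?thesis
    unfolding P_def distrib_left distrib_right omega_ev.simps X_ev.simps z by (simp add: ac_simps)
qed

lemma X_P: "X * P i = X_ev i *\<^sub>R P i"
  unfolding P_def by (rule X_pp) (cases i; simp)

lemma w_P: "w * P i = omega_ev i *\<^sub>R P i"
  unfolding P_def by (rule w_pp) (cases i; simp)

lemma P_X: "P i * X = X_ev i *\<^sub>R P i"
  using X_P[of i] by (simp add: P_def mult.assoc flip: pX_commute) (simp add: pw_X flip: mult.assoc)

lemma P_w: "P i * w = omega_ev i *\<^sub>R P i"
  using w_P[of i] by (simp add: P_def mult.assoc flip: w_pX) (simp add: pw_w flip: mult.assoc)

text \<open>Evaluating \<open>P i * X * P j\<close> from the left and from the right gives two
  multiples of \<open>P i * P j\<close>, likewise with w, and one of the two eigenvalues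
  differs.\<close>

lemma P_mult_neq:
  assumes "i \<noteq> j" shows "P i * P j = 0"
proof -
  have "X_ev i *\<^sub>R (P i * P j) = X_ev j *\<^sub>R (P i * P j)"
    using P_X[of i] X_P[of j] by (metis mult.assoc mult_scaleR_left mult_scaleR_right)
  moreover have "omega_ev i *\<^sub>R (P i * P j) = omega_ev j *\<^sub>R (P i * P j)"
    using P_w[of i] w_P[of j] by (metis mult.assoc mult_scaleR_left mult_scaleR_right)
  ultimately show ?thesis
    using joint_spectrum_inj[of i j] assms by (auto simp: scaleR_cancel_right)
qed

lemma sum_P: "(\<Sum>i\<in>UNIV. P i) = 1"
  using P_sum by (simp add: sum_bi_ix)

lemma P_idem: "P i * P i = P i"
proof -
  have "P i = P i * (\<Sum>j\<in>UNIV. P j)" by (simp add: sum_P)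
  also have "\<dots> = (\<Sum>j\<in>UNIV. if j = i then P i * P i else 0)"
    unfolding sum_distrib_left by (rule sum.cong) (auto simp: P_mult_neq)
  finally show ?thesis by simp
qed

lemma P_mult: "P i * P j = (if i = j then P i else 0)"
  by (simp add: P_idem P_mult_neq)

section \<open>The components of Y and the equations between them\<close>

definition y :: "bi_ix \<Rightarrow> bi_ix \<Rightarrow> 'a" where "y i j = P i * Y * P j"

text \<open>Inserting 1 as the sum of the \<open>P k * P k\<close> between the factors makes
  multiplication in the algebra a matrix multiplication of components.\<close>

lemma sandwich_mult: "P i * (a * b) * P j = (\<Sum>k\<in>UNIV. (P i * a * P k) * (P k * b * P j))"
proof -
  have "P i * (a * b) * P j = P i * a * (\<Sum>k\<in>UNIV. P k) * b * P j"
    by (simp add: sum_P mult.assoc)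
  also have "\<dots> = (\<Sum>k\<in>UNIV. P i * a * (P k * P k) * b * P j)"
    by (simp add: sum_distrib_left sum_distrib_right P_idem)
  finally show ?thesis by (simp add: mult.assoc)
qed

lemma sandwich_X: "P i * (X * a) * P j = X_ev i *\<^sub>R (P i * a * P j)"
    "P i * (a * X) * P j = X_ev j *\<^sub>R (P i * a * P j)"
  by (simp_all add: P_X X_P mult.assoc) (simp_all add: P_X flip: mult.assoc)

lemma sandwich_w: "P i * (w * a) * P j = omega_ev i *\<^sub>R (P i * a * P j)"
  by (simp_all add: P_w flip: mult.assoc)

lemma sandwich_linear: "P i * P j = (if i = j then P i else 0)"
    "P i * X * P j = (if i = j then X_ev i *\<^sub>R P i else 0)"
  "P i * w * P j = (if i = j then omega_ev i *\<^sub>R P i else 0)"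
  by (simp_all add: P_mult X_P w_P mult.assoc)

lemma Z_eq: "Z = X * Y + Y * X - X - Y - w"
  using XY by (simp add: algebra_simps)

text \<open>The anticommutators of X with Y and of X with Z are both X + Y + Z + w. Multiplying the
  first by X on both sides produces XZ + ZX, which is replaced by XY + YX, so Z is
  eliminated.\<close>

lemma X_quad: "X * (X * Y + Y * X) + (X * Y + Y * X) * X
    = 2 *\<^sub>R (X * X) + 2 *\<^sub>R (X * Y + Y * X) + 2 *\<^sub>R (w * X)"
proof -
  let ?T = "X * Y + Y * X"
  have "X * ?T + ?T * X = X * (X + Y + Z + w) + (X + Y + Z + w) * X" by (simp only: XY)
  also have "\<dots> = 2 *\<^sub>R (X * X) + ?T + (X * Z + Z * X) + 2 *\<^sub>R (w * X)"
    by (simp add: algebra_simps wX scaleR_2)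
  also have "X * Z + Z * X = ?T" by (simp only: XZ XY)
  finally show ?thesis by (simp add: scaleR_2 algebra_simps)
qed

lemma Y_quad: "Y * (X * Y + Y * X) + (X * Y + Y * X) * Y
    = 2 *\<^sub>R (Y * Y) + 2 *\<^sub>R (X * Y + Y * X) + 2 *\<^sub>R (w * Y)"
proof -
  let ?T = "X * Y + Y * X"
  have "Y * ?T + ?T * Y = Y * (X + Y + Z + w) + (X + Y + Z + w) * Y" by (simp only: XY)
  also have "\<dots> = 2 *\<^sub>R (Y * Y) + ?T + (Y * Z + Z * Y) + 2 *\<^sub>R (w * Y)"
    by (simp add: algebra_simps wY scaleR_2)
  also have "Y * Z + Z * Y = ?T" by (simp only: XY YZ)
  finally show ?thesis by (simp add: scaleR_2 algebra_simps)
qed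

text \<open>Sandwiching \<open>X_quad\<close> between \<open>P i\<close> and \<open>P j\<close>
  turns X and w into scalars and leaves an equation linear in \<open>y i j\<close>. Off the diagonal
  a nonzero component needs eigenvalues of X with sum 0 or 2; on the diagonal the component is fixed
  unless the eigenvalue is 0.\<close>

lemma y_linear:
  "((X_ev i + X_ev j) * (X_ev i + X_ev j - 2)) *\<^sub>R y i j
    = (if i = j then (2 * X_ev i * (X_ev i + omega_ev i)) *\<^sub>R P i else 0)"
proof -
  have "P i * (X * (X * Y + Y * X) + (X * Y + Y * X) * X) * P j
      = P i * (2 *\<^sub>R (X * X) + 2 *\<^sub>R (X * Y + Y * X) + 2 *\<^sub>R (w * X)) * P j"
    by (simp only: X_quad)
  then have *: "X_ev i *\<^sub>R (X_ev i *\<^sub>R y i j + X_ev j *\<^sub>R y i j) + X_ev j *\<^sub>R (X_ev i *\<^sub>R y i j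
      + X_ev j *\<^sub>R y i j)
      = (if i = j then (2 * X_ev i * X_ev i) *\<^sub>R P i else 0) + 2 *\<^sub>R (X_ev i *\<^sub>R y i j
          + X_ev j *\<^sub>R y i j)
        + (if i = j then (2 * X_ev i * omega_ev i) *\<^sub>R P i else 0)"
    by (cases "i = j")
      (simp_all add: distrib_left distrib_right scaleR_add_right mult.assoc[where 'a
          = real] sandwich_X sandwich_w sandwich_linear y_def[symmetric])
  show ?thesis
  proof (rule real_linear_functional_eqI)
    fix f :: "'a \<Rightarrow> real" assume f: "linear f"
    show "f (((X_ev i + X_ev j) * (X_ev i + X_ev j - 2)) *\<^sub>R y i j) = f (if i
        = j then (2 * X_ev i * (X_ev i + omega_ev i)) *\<^sub>R P i else 0)"
      using arg_cong[OF *, of f] f by (auto simp: lin_simps)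
  qed
qed

text \<open>Sandwiching \<open>Y_quad\<close> instead yields relations between products of two
  components; its diagonal cases determine most of these products.\<close>

lemma y_quadratic:
  "(\<Sum>k\<in>UNIV. (2 * X_ev k + X_ev i + X_ev j - 2) *\<^sub>R (y i k * y k j))
      = (2 * (X_ev i + X_ev j + omega_ev i)) *\<^sub>R y i j"
proof -
  have YY: "P i * (Y * Y) * P j = (\<Sum>k\<in>UNIV. y i k * y k j)"
    by (simp add: sandwich_mult y_def)
  have YXY: "P i * (Y * (X * Y)) * P j = (\<Sum>k\<in>UNIV. X_ev k *\<^sub>R (y i k * y k j))"
    by (simp add: sandwich_mult[of i Y "X * Y"] sandwich_X y_def)
  have YYX: "P i * (Y * (Y * X)) * P j = (\<Sum>k\<in>UNIV. X_ev j *\<^sub>R (y i k * y k j))"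
    by (simp add: sandwich_mult[of i Y "Y * X"] sandwich_X y_def)
  have XYY: "P i * (X * (Y * Y)) * P j = (\<Sum>k\<in>UNIV. X_ev i *\<^sub>R (y i k * y k j))"
    by (simp add: sandwich_X YY scaleR_sum_right)
  have "P i * (Y * (X * Y + Y * X) + (X * Y + Y * X) * Y) * P j
      = P i * (2 *\<^sub>R (Y * Y) + 2 *\<^sub>R (X * Y + Y * X) + 2 *\<^sub>R (w * Y)) * P j"
    by (simp only: Y_quad)
  then have *: "P i * (Y * (X * Y)) * P j + P i * (Y * (Y * X)) * P j
      + (P i * (X * (Y * Y)) * P j + P i * (Y * (X * Y)) * P j)
     = 2 *\<^sub>R (P i * (Y * Y) * P j) + 2 *\<^sub>R (X_ev i *\<^sub>R y i j + X_ev j *\<^sub>R y i j)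
         + (2 * omega_ev i) *\<^sub>R y i j"
    by (simp add: distrib_left distrib_right sandwich_X sandwich_w y_def mult.assoc[of X Y]
        mult.assoc[of Y X])
  show ?thesis
  proof (rule real_linear_functional_eqI)
    fix f :: "'a \<Rightarrow> real" assume f: "linear f"
    show "f (\<Sum>k\<in>UNIV. (2 * X_ev k + X_ev i + X_ev j - 2) *\<^sub>R (y i k * y k j))
        = f ((2 * (X_ev i + X_ev j + omega_ev i)) *\<^sub>R y i j)"
      using arg_cong[OF *, of f] f unfolding YY YXY YYX XYY
      by (simp add: lin_simps linear_sum sum.distrib sum_distrib_left sum_subtractf)
  qed
qed

lemma cubic_sandwich:
  assumes "A * (A * A) = 4 *\<^sub>R A"
  shows "(\<Sum>k\<in>UNIV. \<Sum>l\<in>UNIV. (P i * A * P k) * ((P k * A * P l) * (P l * A * P j)))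
      = 4 *\<^sub>R (P i * A * P j)"
proof -
  have "P i * (A * (A * A)) * P j = 4 *\<^sub>R (P i * A * P j)" by (simp add: assms)
  then show ?thesis
    by (simp add: sandwich_mult[of i A "A * A"] sandwich_mult[of _ A A] sum_distrib_left)
qed

definition z :: "bi_ix \<Rightarrow> bi_ix \<Rightarrow> 'a" where "z i j = P i * Z * P j"

text \<open>The first relation expresses Z through X, Y and w, so the components of Z bring in no
  new unknowns, and the cubic relation for Z becomes a condition on those of Y.\<close>

lemma z_eq:
  "z i j = (X_ev i + X_ev j - 1) *\<^sub>R y i j
    - (if i = j then (X_ev i + omega_ev i) *\<^sub>R P i else 0)"
proof -
  have "z i j = P i * (X * Y + Y * X - X - Y - w) * P j"
    unfolding z_def by (simp only: Z_eq[symmetric])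
  also have "\<dots> = X_ev i *\<^sub>R y i j + X_ev j *\<^sub>R y i j - P i * X * P j - y i j - P i * w * P j"
    by (simp add: distrib_left distrib_right left_diff_distrib right_diff_distrib sandwich_X y_def)
  finally show ?thesis unfolding sandwich_linear by (auto simp add: algebra_simps)
qed

lemma y_eq_0_omega:
  assumes "omega_ev i \<noteq> omega_ev j" shows "y i j = 0"
proof -
  have "omega_ev i *\<^sub>R y i j = omega_ev j *\<^sub>R y i j"
    using sandwich_w[of i Y j] unfolding wY y_def by (auto simp add: mult.assoc w_P)
  then show ?thesis using assms by simp
qed

text \<open>Between different eigenvalues of omega the component vanishes because w commutes with Y.
  Within one eigenvalue the only zero entries of \<open>Y_entry\<close> join C1 and C3, where the
  eigenvalues of X add up to -2 and \<open>y_linear\<close> applies.\<close>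

lemma y_eq_0:
  assumes "Y_entry i j = 0" shows "y i j = 0"
proof (cases "omega_ev i = omega_ev j")
  case True
  then have "i \<noteq> j" "(X_ev i + X_ev j) * (X_ev i + X_ev j - 2) \<noteq> 0"
    using assms by (cases i; cases j; simp)+
  then show ?thesis using y_linear[of i j] by simp
qed (rule y_eq_0_omega)

lemma P_y: "P i * y i j = y i j" "y i j * P j = y i j"
  by (simp_all add: y_def mult.assoc P_idem) (simp add: P_idem flip: mult.assoc)

lemma P_y_assoc: "P i * (y i j * a) = y i j * a"
  by (simp add: P_y flip: mult.assoc)

lemma y_diag:
  assumes "i \<noteq> C3" shows "y i i = Y_entry i i *\<^sub>R P i"
proof -
  let ?c = "(X_ev i + X_ev i) * (X_ev i + X_ev i - 2)"
  have c: "?c \<noteq> 0" "2 * X_ev i * (X_ev i + omega_ev i) = ?c * Y_entry i i"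
    using assms by (cases i; simp)+
  then have "?c *\<^sub>R y i i = ?c *\<^sub>R (Y_entry i i *\<^sub>R P i)"
    using y_linear[of i i] by simp
  then show ?thesis using c(1) by (simp only: scaleR_cancel_left) simp
qed

text \<open>At B1, B2 and C1 just one other label is coupled to the given one, so the diagonal case
  of \<open>y_quadratic\<close> contains a single unknown product.\<close>

lemma y_products:
  "y B1 B2 * y B2 B1 = 3 *\<^sub>R P B1" "y B2 B1 * y B1 B2 = 3 *\<^sub>R P B2"
  "y C1 C2 * y C2 C1 = (- 1) *\<^sub>R P C1"
proof -
  have a: "y B1 B1 = P B1" "y B2 B2 = - P B2" "y C1 C1 = - P C1"
    using y_diag[of B1] y_diag[of B2] y_diag[of C1] by simp_all
  note s = sum_bi_ix y_eq_0 a P_idem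
  show "y B1 B2 * y B2 B1 = 3 *\<^sub>R P B1"
  proof (rule real_linear_functional_eqI)
    fix f :: "'a \<Rightarrow> real" assume f: "linear f"
    show "f (y B1 B2 * y B2 B1) = f (3 *\<^sub>R P B1)"
      using arg_cong[OF y_quadratic[of B1 B1], of f] f by (simp add: s lin_simps)
  qed
  show "y B2 B1 * y B1 B2 = 3 *\<^sub>R P B2"
  proof (rule real_linear_functional_eqI)
    fix f :: "'a \<Rightarrow> real" assume f: "linear f"
    show "f (y B2 B1 * y B1 B2) = f (3 *\<^sub>R P B2)"
      using arg_cong[OF y_quadratic[of B2 B2], of f] f by (simp add: s lin_simps)
  qed
  show "y C1 C2 * y C2 C1 = (- 1) *\<^sub>R P C1"
  proof (rule real_linear_functional_eqI)
    fix f :: "'a \<Rightarrow> real" assume f: "linear f"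
    show "f (y C1 C2 * y C2 C1) = f ((- 1) *\<^sub>R P C1)"
      using arg_cong[OF y_quadratic[of C1 C1], of f] f by (simp add: s lin_simps)
  qed
qed

text \<open>The only diagonal entry that \<open>y_linear\<close> leaves open, since \<open>X\<close> has eigenvalue 0 there. The cubic
  relation for \<open>Y\<close> leaves \<open>0, -3, -4\<close>; the one for \<open>Z\<close>, whose entry is \<open>-8 - y\<close>, singles out \<open>-4\<close>.\<close>

lemma y_C3_C3: "y C3 C3 = (- 4) *\<^sub>R P C3"
proof -
  define t where "t = y C3 C3"
  define q where "q = y C3 C2 * y C2 C3"
  have a: "y C1 C1 = - P C1" "y C2 C2 = 5 *\<^sub>R P C2"
    using y_diag[of C1] y_diag[of C2] by simp_all
  note s = sum_bi_ix y_eq_0 a P_idem P_y P_y_assoc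
  \<comment> \<open>Only k = C2 and k = C3 contribute at C3, so q is a polynomial in t and both
    cubic relations become equations for t alone.\<close>
  have q: "q = t * t + 8 *\<^sub>R t"
  proof (rule real_linear_functional_eqI)
    fix f :: "'a \<Rightarrow> real" assume f: "linear f"
    show "f q = f (t * t + 8 *\<^sub>R t)"
      using arg_cong[OF y_quadratic[of C3 C3], of f] f by (simp add: s lin_simps q_def t_def)
  qed
  have P_t: "P C3 * t = t" "t * P C3 = t" "P C3 * (t * a) = t * a" for a
    by (simp_all add: t_def P_y P_y_assoc)
  have yq: "y C3 C2 * y C2 C3 = q" "y C3 C2 * (y C2 C3 * a) = q * a" for a
    by (simp_all add: q_def mult.assoc)
  have yc: "5 *\<^sub>R q + q * t + t * q + t * (t * t) = 4 *\<^sub>R t"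
    using cubic_sandwich[OF Y3, of C3 C3] unfolding y_def[symmetric]
    by (simp add: s yq add.assoc flip: t_def)
  \<comment> \<open>The components of Z that couple C2 and C3 agree with those of Y except at (C3,
    C3). Hence \<open>zc\<close> is \<open>yc\<close> with t replaced by - t - 8 P C3 outside
    q.\<close>
  have z: "z C3 C3 = - t - 8 *\<^sub>R P C3" "z C3 C2 = y C3 C2" "z C2 C3 = y C2 C3"
     "z C2 C2 = 5 *\<^sub>R P C2" "z C3 A1 = 0" "z C3 B1 = 0" "z C3 B2 = 0" "z C3 C1 = 0" "z C3 D1 = 0"
     "z A1 C3 = 0" "z B1 C3 = 0" "z B2 C3 = 0" "z C1 C3 = 0" "z D1 C3 = 0"
    by (simp_all add: z_eq y_eq_0 a flip: t_def scaleR_left_diff_distrib)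
  have zc: "5 *\<^sub>R q + q * z C3 C3 + z C3 C3 * q + z C3 C3 * (z C3 C3 * z C3 C3) = 4 *\<^sub>R z C3 C3"
    using cubic_sandwich[OF Z3, of C3 C3] unfolding z_def[symmetric]
    by (simp add: sum_bi_ix z(2-) yq P_y P_y_assoc add.assoc)
  have 1: "3 *\<^sub>R (t * (t * t)) + 21 *\<^sub>R (t * t) + 36 *\<^sub>R t = 0"
  proof (rule real_linear_functional_eqI)
    fix f :: "'a \<Rightarrow> real" assume f: "linear f"
    show "f (3 *\<^sub>R (t * (t * t)) + 21 *\<^sub>R (t * t) + 36 *\<^sub>R t) = f 0"
      using arg_cong[OF yc, of f] f unfolding q by (simp add: lin_simps)
  qed
  have 2: "3 *\<^sub>R (t * (t * t)) + 51 *\<^sub>R (t * t) + 276 *\<^sub>R t + 480 *\<^sub>R P C3 = 0"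
  proof (rule real_linear_functional_eqI)
    fix f :: "'a \<Rightarrow> real" assume f: "linear f"
    show "f (3 *\<^sub>R (t * (t * t)) + 51 *\<^sub>R (t * t) + 276 *\<^sub>R t + 480 *\<^sub>R P C3) = f 0"
      using arg_cong[OF zc, of f] f unfolding q z(1) by (simp add: lin_simps P_t P_idem)
  qed
  \<comment> \<open>The difference of the two cubics says that (t + 4 P C3) squared is 0, which does
    not yet fix t. Substituting it into the first cubic lowers the degree to 12 t + 48 P C3 =
    0.\<close>
  have tt: "t * t = (- 8) *\<^sub>R t - 16 *\<^sub>R P C3"
  proof (rule real_linear_functional_eqI)
    fix f :: "'a \<Rightarrow> real" assume f: "linear f"
    show "f (t * t) = f ((- 8) *\<^sub>R t - 16 *\<^sub>R P C3)"
      using arg_cong[OF 1, of f] arg_cong[OF 2, of f] f by (simp add: lin_simps)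
  qed
  have "t = (- 4) *\<^sub>R P C3"
  proof (rule real_linear_functional_eqI)
    fix f :: "'a \<Rightarrow> real" assume f: "linear f"
    show "f t = f ((- 4) *\<^sub>R P C3)"
      using arg_cong[OF 1, of f] f unfolding tt by (simp add: lin_simps P_t tt)
  qed
  then show ?thesis by (simp only: t_def)
qed

text \<open>C2 is coupled to both C1 and C3, so two products are unknown there. The relation
  \<open>y_quadratic\<close> gives their difference and the cubic relation for Y supplies a second
  equation.\<close>

lemma y_products_8:
  "y C2 C1 * y C1 C2 = (- 1) *\<^sub>R P C2" "y C2 C3 * y C3 C2 = (- 16) *\<^sub>R P C2"
      "y C3 C2 * y C2 C3 = (- 16) *\<^sub>R P C3"
proof -
  have a: "y C1 C1 = - P C1" "y C2 C2 = 5 *\<^sub>R P C2" "y C3 C3 = (- 4) *\<^sub>R P C3"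
    using y_diag[of C1] y_diag[of C2] y_C3_C3 by simp_all
  note s = sum_bi_ix y_eq_0 a P_idem P_y P_y_assoc
  show "y C3 C2 * y C2 C3 = (- 16) *\<^sub>R P C3"
  proof (rule real_linear_functional_eqI)
    fix f :: "'a \<Rightarrow> real" assume f: "linear f"
    show "f (y C3 C2 * y C2 C3) = f ((- 16) *\<^sub>R P C3)"
      using arg_cong[OF y_quadratic[of C3 C3], of f] f by (simp add: s lin_simps)
  qed
  let ?u = "y C2 C1 * y C1 C2" and ?v = "y C2 C3 * y C3 C2"
  have v: "?v = ?u - 15 *\<^sub>R P C2"
  proof (rule real_linear_functional_eqI)
    fix f :: "'a \<Rightarrow> real" assume f: "linear f"
    show "f ?v = f (?u - 15 *\<^sub>R P C2)"
      using arg_cong[OF y_quadratic[of C2 C2], of f] f by (simp add: s lin_simps)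
  qed
  have c: "9 *\<^sub>R ?u + 6 *\<^sub>R ?v + 105 *\<^sub>R P C2 = 0"
  proof (rule real_linear_functional_eqI)
    fix f :: "'a \<Rightarrow> real" assume f: "linear f"
    show "f (9 *\<^sub>R ?u + 6 *\<^sub>R ?v + 105 *\<^sub>R P C2) = f 0"
      using arg_cong[OF cubic_sandwich[OF Y3, of C2 C2], of f] f unfolding y_def[symmetric]
      by (simp add: s lin_simps)
  qed
  show u: "?u = (- 1) *\<^sub>R P C2"
  proof (rule real_linear_functional_eqI)
    fix f :: "'a \<Rightarrow> real" assume f: "linear f"
    show "f ?u = f ((- 1) *\<^sub>R P C2)"
      using arg_cong[OF c, of f] f unfolding v by (simp add: lin_simps)
  qed
  show "?v = (- 16) *\<^sub>R P C2"
    unfolding v u by (simp only: scaleR_left_diff_distrib[symmetric]) simp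
qed

text \<open>Dividing by \<open>Y_entry\<close> normalizes the components to matrix units. Since Y
  does not couple C1 and C3 directly, the units between them go through C2; the factors are the
  inverses of (-1) * 2 and (-8) * 1. Units between different eigenvalues of omega are 0.\<close>

fun E :: "bi_ix \<Rightarrow> bi_ix \<Rightarrow> 'a" where
  "E C1 C3 = (- 1/2) *\<^sub>R (y C1 C2 * y C2 C3)"
| "E C3 C1 = (- 1/8) *\<^sub>R (y C3 C2 * y C2 C1)"
| "E i j = (if i = j then P i else if Y_entry i j = 0 then 0 else (1 / Y_entry i j) *\<^sub>R y i j)"

lemma E_diag: "E i i = P i"
  by (cases i) simp_all

lemma y_eq_E: "y i j = Y_entry i j *\<^sub>R E i j"
proof (cases "i = j")
  case True
  then show ?thesis by (cases "i = C3") (simp_all add: E_diag y_diag y_C3_C3)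
next
  case False
  then show ?thesis by (cases i; cases j) (simp_all add: y_eq_0)
qed

text \<open>If neither factor is diagonal or zero, both are multiples of components or products of
  components, and the claim reduces to \<open>y_products\<close> and
  \<open>y_products_8\<close>.\<close>

lemma y_E: "y i j * E j k = Y_entry i j *\<^sub>R E i k"
proof (cases "Y_entry i j = 0 \<or> i = j \<or> j = k")
  case True
  moreover have "P i * E i k = E i k"
    by (cases i; cases k) (simp_all add: P_y P_y_assoc P_idem)
  ultimately show ?thesis by (auto simp: y_eq_0 y_eq_E[of i i] E_diag P_y) (simp_all add: E_diag
      y_eq_E P_y)?
next
  case False
  then show ?thesis
    by (cases i; cases j; cases k)
       (simp_all add: y_products y_products_8 P_y flip: mult.assoc)
qed

lemma P_E: "P i * E j k = (if i = j then E j k else 0)"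
proof -
  have "P j * E j k = E j k"
    by (cases j; cases k) (simp_all add: P_y P_y_assoc P_idem)
  then show ?thesis by (metis P_mult mult.assoc mult_zero_left)
qed

lemma X_E: "X * E j k = X_ev j *\<^sub>R E j k" and w_E: "w * E j k = omega_ev j *\<^sub>R E j k"
  using P_E[of j j k] by (metis X_P w_P mult.assoc mult_scaleR_left)+

text \<open>Left multiplication by Y transforms the first index exactly as \<open>Y_mat\<close>
  transforms \<open>eigvec\<close>. Together with \<open>X_E\<close> and \<open>w_E\<close> this
  makes the span of the matrix units stable under left multiplication by the generators.\<close>

lemma Y_E: "Y * E j k = (\<Sum>i\<in>UNIV. Y_entry i j *\<^sub>R E i k)"
proof -
  have "Y * E j k = (\<Sum>i\<in>UNIV. P i) * (Y * (P j * E j k))" by (simp add: P_E sum_P)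
  also have "\<dots> = (\<Sum>i\<in>UNIV. y i j * E j k)" by (simp add: sum_distrib_right y_def mult.assoc)
  finally show ?thesis by (simp add: y_E)
qed

lemma E_eq_0: "omega_ev i \<noteq> omega_ev j \<Longrightarrow> E i j = 0"
  by (cases i; cases j) simp_all

lemma E_P: "E i j * P j = E i j"
  by (cases i; cases j) (simp_all add: P_y P_idem mult.assoc)

end

section \<open>The zero weight space of the threefold tensor product\<close>

definition tvec :: "complex ^ 'a::finite \<Rightarrow> complex ^ 'b::finite \<Rightarrow> complex ^ ('a \<times> 'b)" where
  "tvec u v = (\<chi> i. u $ fst i * v $ snd i)"

lemma kron_tvec: "kron A B *v tvec u v = tvec (A *v u) (B *v v)"
  by (simp add: vec_eq_iff kron_def tvec_def matrix_vector_mult_def sum_product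
      sum.cartesian_product
      case_prod_beta ac_simps)

lemma tvec_simps:
  "tvec (u + u') v = tvec u v + tvec u' v" "tvec u (v + v') = tvec u v + tvec u v'"
  "tvec (u - u') v = tvec u v - tvec u' v" "tvec u (v - v') = tvec u v - tvec u v'"
  "tvec (c *s u) v = c *s tvec u v" "tvec u (c *s v) = c *s tvec u v"
  "tvec (- u) v = - tvec u v" "tvec u (- v) = - tvec u v"
  "tvec 0 v = 0" "tvec u 0 = 0"
  by (simp_all add: vec_eq_iff tvec_def algebra_simps)

definition assoc_vec :: "complex ^ ('a::finite \<times> 'b::finite \<times> 'c::finite) \<Rightarrow> complex ^ (('a \<times> 'b) \<times>
    'c)" where
  "assoc_vec v = (\<chi> i. v $ (fst (fst i), snd (fst i), snd i))"

lemma assoc_vec_tvec: "assoc_vec (tvec u (tvec v w)) = tvec (tvec u v) w"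
  by (simp add: vec_eq_iff assoc_vec_def tvec_def)

lemma assoc_vec_simps:
  "assoc_vec (u + v) = assoc_vec u + assoc_vec v" "assoc_vec (u - v) = assoc_vec u - assoc_vec v"
  "assoc_vec (- u) = - assoc_vec u" "assoc_vec (c *s u) = c *s assoc_vec u" "assoc_vec 0 = 0"
  by (simp_all add: vec_eq_iff assoc_vec_def)

lemma reassoc_vec: "reassoc A *v assoc_vec v = assoc_vec (A *v v)"
proof -
  have "(\<Sum>k\<in>UNIV. reassoc A $ i $ k * assoc_vec v $ k) = assoc_vec (A *v v) $ i" for i
    unfolding reassoc_def assoc_vec_def matrix_vector_mult_def vec_lambda_beta
    by (rule sum_UNIV_reassoc)
  then show ?thesis by (simp add: vec_eq_iff matrix_vector_mult_def)
qed

lemma reassoc_tvec: "reassoc (kron A B) *v tvec (tvec u v) w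
    = assoc_vec (tvec (A *v u) (B *v tvec v w))"
  by (simp only: assoc_vec_tvec[symmetric] reassoc_vec kron_tvec)

abbreviation evec :: "3 \<Rightarrow> complex ^ 3" where "evec i \<equiv> axis i 1"

lemma fund_rep_basis:
  "fund_rep (Osp F_plus) *v evec 1 = 0" "fund_rep (Osp F_plus) *v evec 2 = (1/2) *s evec 3"
  "fund_rep (Osp F_plus) *v evec 3 = (1/2) *s evec 1"
  "fund_rep (Osp F_minus) *v evec 1 = (1/2) *s evec 3" "fund_rep (Osp F_minus) *v evec 2 = 0"
  "fund_rep (Osp F_minus) *v evec 3 = (- 1/2) *s evec 2"
  "fund_rep (Osp H_zero) *v evec 1 = (1/2) *s evec 1"
      "fund_rep (Osp H_zero) *v evec 2 = (- 1/2) *s evec 2"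
  "fund_rep (Osp H_zero) *v evec 3 = 0"
  "fund_rep R_inv *v evec 1 = evec 1" "fund_rep R_inv *v evec 2 = evec 2"
      "fund_rep R_inv *v evec 3 = - evec 3"
  by (simp_all add: vec_eq_iff forall_3 fund_Fp_def fund_Fm_def smat_def matrix_vector_mult_def
      sum_3 axis_def)

lemma smat_vec: "smat c A *v v = c *s (A *v v)"
  by (simp add: vec_eq_iff smat_def matrix_vector_mult_def sum_distrib_left ac_simps)

lemma matrix_vec_simps:
  fixes A B :: "'n::finite cmat"
  shows "A *v (u + v) = A *v u + A *v v" "A *v (u - v) = A *v u - A *v v" "A *v (- v) = - (A *v v)"
  "A *v (c *s v) = c *s (A *v v)" "A *v 0 = 0"
  "(A + B) *v v = A *v v + B *v v" "(A - B) *v v = A *v v - B *v v" "(- A) *v v = - (A *v v)"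
  "smat c A *v v = c *s (A *v v)" "(A ** B) *v v = A *v (B *v v)" "mat 1 *v v = v"
  by (simp_all add: smat_vec matrix_vector_mul_assoc[symmetric])
     (simp_all add: vec_eq_iff matrix_vector_mult_def sum.distrib sum_subtractf sum_negf
         sum_distrib_left algebra_simps)

text \<open>The operator \<open>grade_casimir\<close> has the eigenvalues \<open>5, -3, 1\<close> on the constituents of two factors and
  \<open>7, -5, 3, -1\<close> on those of three; they are rescaled to the spectra \<open>-2, 2, 0\<close> of \<open>X\<close> and
  \<open>14, -4, 8, 2\<close> of \<open>\<omega>\<close>.\<close>

definition mid_casimir :: "(3 \<times> 3) cmat" where
  "mid_casimir = smat (1/2) (mat 1 - grade_casimir (tensor_rep fund_rep fund_rep))"

definition X_mat :: "((3 \<times> 3) \<times> 3) cmat" where "X_mat = kron mid_casimir (mat 1)"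
definition Y_mat :: "((3 \<times> 3) \<times> 3) cmat" where "Y_mat = reassoc (kron (mat 1) mid_casimir)"
definition w_mat :: "((3 \<times> 3) \<times> 3) cmat" where
  "w_mat = smat (7/2) (mat 1) + smat (3/2) (grade_casimir V_rep)"
text \<open>Z is obtained by solving the relation for the anticommutator of X and Y, so its
  relations with X and with Y are what carries content.\<close>

definition Z_mat :: "((3 \<times> 3) \<times> 3) cmat" where
  "Z_mat = X_mat ** Y_mat + Y_mat ** X_mat - X_mat - Y_mat - w_mat"

section \<open>The Casimir operators on the tensor basis and their joint eigenvectors\<close>

lemma mid_casimir_vec:
  "mid_casimir *v v = (1/2) *s (v - grade_casimir (tensor_rep fund_rep fund_rep) *v v)"
  by (simp add: mid_casimir_def matrix_vec_simps)

lemma grade_casimir_vec: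
  "grade_casimir \<rho> *v v = 8 *s (\<rho> (Osp F_plus) *v (\<rho> (Osp F_minus) *v (\<rho> R_inv *v v))
    - \<rho> (Osp F_minus) *v (\<rho> (Osp F_plus) *v (\<rho> R_inv *v v))) + \<rho> R_inv *v v"
  by (simp add: grade_casimir_def scasimir_def comm_mat_def matrix_vec_simps)

text \<open>These are the pairs that occur as adjacent factors in a triple of weight zero. The pairs
  11 and 22 have weight 1 and -1, which no third factor compensates.\<close>

lemma mid_casimir_table:
  "mid_casimir *v tvec (evec 1) (evec 2)
      = (- 2) *s tvec (evec 1) (evec 2) - 2 *s tvec (evec 3) (evec 3)"
  "mid_casimir *v tvec (evec 1) (evec 3) = (- 2) *s tvec (evec 3) (evec 1)"
  "mid_casimir *v tvec (evec 2) (evec 1)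
      = (- 2) *s tvec (evec 2) (evec 1) + 2 *s tvec (evec 3) (evec 3)"
  "mid_casimir *v tvec (evec 2) (evec 3) = (- 2) *s tvec (evec 3) (evec 2)"
  "mid_casimir *v tvec (evec 3) (evec 1) = (- 2) *s tvec (evec 1) (evec 3)"
  "mid_casimir *v tvec (evec 3) (evec 2) = (- 2) *s tvec (evec 2) (evec 3)"
  "mid_casimir *v tvec (evec 3) (evec 3)
      = 2 *s tvec (evec 1) (evec 2) - 2 *s tvec (evec 2) (evec 1) + 4 *s tvec (evec 3) (evec 3)"
  unfolding mid_casimir_vec grade_casimir_vec tensor_rep.simps
  by (simp_all add: matrix_vec_simps kron_tvec tvec_simps fund_rep_basis del: fund_rep.simps)
    (simp_all add: vec_eq_iff algebra_simps)

abbreviation bvec :: "3 \<Rightarrow> 3 \<Rightarrow> 3 \<Rightarrow> complex ^ ((3 \<times> 3) \<times> 3)" where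
  "bvec i j k \<equiv> tvec (tvec (evec i) (evec j)) (evec k)"

lemma grade_casimir_table:
  "grade_casimir V_rep *v bvec 1 2 3 = - bvec 1 2 3 + 4 *s bvec 1 3 2 + 4 *s bvec 3 2 1
      - 4 *s bvec 3 3 3"
  "grade_casimir V_rep *v bvec 1 3 2 = 4 *s bvec 1 2 3 - bvec 1 3 2 + 4 *s bvec 3 1 2
      + 4 *s bvec 3 3 3"
  "grade_casimir V_rep *v bvec 2 1 3 = - bvec 2 1 3 + 4 *s bvec 2 3 1 + 4 *s bvec 3 1 2
      + 4 *s bvec 3 3 3"
  "grade_casimir V_rep *v bvec 2 3 1 = 4 *s bvec 2 1 3 - bvec 2 3 1 + 4 *s bvec 3 2 1
      - 4 *s bvec 3 3 3"
  "grade_casimir V_rep *v bvec 3 1 2 = 4 *s bvec 1 3 2 + 4 *s bvec 2 1 3 - bvec 3 1 2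
      - 4 *s bvec 3 3 3"
  "grade_casimir V_rep *v bvec 3 2 1 = 4 *s bvec 1 2 3 + 4 *s bvec 2 3 1 - bvec 3 2 1
      + 4 *s bvec 3 3 3"
  "grade_casimir V_rep *v bvec 3 3 3 = 4 *s bvec 1 2 3 - 4 *s bvec 1 3 2 - 4 *s bvec 2 1 3
      + 4 *s bvec 2 3 1 + 4 *s bvec 3 1 2 - 4 *s bvec 3 2 1 + 11 *s bvec 3 3 3"
  unfolding grade_casimir_vec V_rep_def tensor_rep.simps
  by (simp_all add: matrix_vec_simps kron_tvec tvec_simps fund_rep_basis del: fund_rep.simps)
    (simp_all add: vec_eq_iff algebra_simps)

text \<open>Joint eigenvectors of \<open>X_mat\<close> and \<open>w_mat\<close> on the zero weight
  space; their scaling fixes the off-diagonal entries of \<open>Y_entry\<close>.\<close>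

fun eigvec :: "bi_ix \<Rightarrow> complex ^ ((3 \<times> 3) \<times> 3)" where
  "eigvec A1 = bvec 1 2 3 + bvec 1 3 2 + bvec 2 1 3 + bvec 2 3 1 + bvec 3 1 2 + bvec 3 2 1"
| "eigvec B1 = (- 2) *s bvec 1 2 3 + bvec 1 3 2 - 2 *s bvec 2 1 3 + bvec 2 3 1 + bvec 3 1 2
    + bvec 3 2 1"
| "eigvec B2 = - bvec 1 3 2 - bvec 2 3 1 + bvec 3 1 2 + bvec 3 2 1"
| "eigvec C1 = - bvec 1 3 2 + bvec 2 3 1 - bvec 3 1 2 + bvec 3 2 1"
| "eigvec C2 = 2 *s bvec 1 2 3 - bvec 1 3 2 - 2 *s bvec 2 1 3 + bvec 2 3 1 + bvec 3 1 2
    - bvec 3 2 1 + 4 *s bvec 3 3 3"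
| "eigvec C3 = bvec 1 2 3 - bvec 2 1 3 + bvec 3 3 3"
| "eigvec D1 = bvec 1 2 3 - bvec 1 3 2 - bvec 2 1 3 + bvec 2 3 1 + bvec 3 1 2 - bvec 3 2 1
    + 2 *s bvec 3 3 3"

text \<open>The functionals dual to \<open>eigvec\<close>, extended to all of the tensor product by
  ignoring the components of nonzero weight.\<close>

fun eigcoord :: "bi_ix \<Rightarrow> complex ^ ((3 \<times> 3) \<times> 3) \<Rightarrow> complex" where
  "eigcoord A1 v = (v $ ((1, 2), 3) + v $ ((1, 3), 2) + v $ ((2, 1), 3) + v $ ((2, 3), 1)
      + v $ ((3, 1), 2) + v $ ((3, 2), 1)) / 6"
| "eigcoord B1 v = (- 2 * v $ ((1, 2), 3) + v $ ((1, 3), 2) - 2 * v $ ((2, 1), 3)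
    + v $ ((2, 3), 1) + v $ ((3, 1), 2) + v $ ((3, 2), 1)) / 12"
| "eigcoord B2 v = (- v $ ((1, 3), 2) - v $ ((2, 3), 1) + v $ ((3, 1), 2) + v $ ((3, 2), 1)) / 4"
| "eigcoord C1 v = (- v $ ((1, 3), 2) + v $ ((2, 3), 1) - v $ ((3, 1), 2) + v $ ((3, 2), 1)) / 4"
| "eigcoord C2 v = (- 2 * v $ ((1, 2), 3) + v $ ((1, 3), 2) + 2 * v $ ((2, 1), 3)
    - v $ ((2, 3), 1) - v $ ((3, 1), 2) + v $ ((3, 2), 1) + 4 * v $ ((3, 3), 3)) / 4"
| "eigcoord C3 v = v $ ((1, 2), 3) - v $ ((2, 1), 3) - v $ ((3, 3), 3)"
| "eigcoord D1 v = (v $ ((1, 2), 3) - v $ ((1, 3), 2) - v $ ((2, 1), 3) + v $ ((2, 3), 1)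
    + v $ ((3, 1), 2) - v $ ((3, 2), 1) - 2 * v $ ((3, 3), 3)) / 2"

lemma X_mat_eigvec: "X_mat *v eigvec i = of_real (X_ev i) *s eigvec i"
  by (cases i) (simp_all add: X_mat_def matrix_vec_simps kron_tvec mid_casimir_table tvec_simps,
     simp_all add: vec_eq_iff algebra_simps)

lemma Y_mat_eigvec: "Y_mat *v eigvec j = (\<Sum>i\<in>UNIV. of_real (Y_entry i j) *s eigvec i)"
  by (cases j) (simp_all add: Y_mat_def sum_bi_ix matrix_vec_simps reassoc_tvec mid_casimir_table
      tvec_simps
     assoc_vec_simps assoc_vec_tvec, simp_all add: vec_eq_iff algebra_simps)

lemma w_mat_eigvec: "w_mat *v eigvec i = of_real (omega_ev i) *s eigvec i"
  by (cases i) (simp_all add: w_mat_def matrix_vec_simps grade_casimir_table,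
     simp_all add: vec_eq_iff algebra_simps)

lemma b_component: "bvec i j k $ ((i', j'), k') = (if i' = i \<and> j' = j \<and> k' = k then 1 else 0)"
  by (simp add: tvec_def axis_def)

lemma eigcoord_eigvec: "eigcoord i (eigvec j) = (if i = j then 1 else 0)"
  by (cases i; cases j) (simp_all add: b_component)

lemma eigcoord_linear: "eigcoord i (u + v) = eigcoord i u + eigcoord i v"
    "eigcoord i (c *s v) = c * eigcoord i v" "eigcoord i 0 = 0"
  by (cases i; simp add: field_simps)+

section \<open>Weights and the expansion of zero weight vectors\<close>

definition wt :: "3 \<Rightarrow> complex" where "wt i = (if i = 1 then 1/2 else if i = 2 then - 1/2 else 0)"

lemma fund_H: "fund_rep (Osp H_zero) $ i $ j = (if i = j then wt i else 0)"
  using exhaust_3[of i] exhaust_3[of j] by (auto simp: wt_def smat_def)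

lemma V_H_component:
  "(V_rep (Osp H_zero) *v v) $ ((i, j), k) = (wt i + wt j + wt k) * v $ ((i, j), k)"
proof -
  have "V_rep (Osp H_zero) $ ((i, j), k) $ q = (if q
      = ((i, j), k) then wt i + wt j + wt k else 0)" for q
    by (cases q rule: prod.exhaust; cases "fst q"; auto simp: V_rep_def kron_def mat_def fund_H
        simp del: fund_rep.simps)
  then show ?thesis by (simp add: matrix_vector_mult_def if_distrib[of "\<lambda>x. x * _"] cong: if_cong)
qed

text \<open>H is diagonal in the tensor basis, so such a vector is supported on the seven triples of
  weight zero, where the expansion can be compared componentwise.\<close>

lemma zero_weight_expansion:
  assumes "V_rep (Osp H_zero) *v v = 0"
  shows "v = (\<Sum>i\<in>UNIV. eigcoord i v *s eigvec i)"
proof -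
  have z: "v $ ((i, j), k) = 0" if "wt i + wt j + wt k \<noteq> 0" for i j k
    using V_H_component[of v i j k] assms that by simp
  show ?thesis
    by (simp add: sum_bi_ix vec_eq_iff b_component forall_3 split_paired_all)
      (simp add: z wt_def field_simps)
qed

lemma eigvec_zero_weight: "V_rep (Osp H_zero) *v eigvec i = 0"
  by (simp add: vec_eq_iff V_H_component split_paired_all)
     (cases i; auto simp: b_component wt_def)

text \<open>Every triple of weight zero contains the index 3 once or three times, and R is -1 on
  exactly that basis vector of a factor.\<close>

lemma eigvec_R: "V_rep R_inv *v eigvec i = - eigvec i"
  by (cases i) (simp_all add: V_rep_def matrix_vec_simps kron_tvec fund_rep_basis tvec_simps del:
      fund_rep.simps)

section \<open>Membership of the four operators in the centralizer\<close>

lemma centralizer_V_simps: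
  assumes "M \<in> carrier (osp_centralizer V_rep)"
  shows "M ** V_rep (Osp a) = V_rep (Osp a) ** M"
  using assms by (simp add: centralizer_iff_basis)

lemma centralizer_V_vec:
  assumes "M \<in> carrier (osp_centralizer V_rep)"
  shows "M *v (V_rep (Osp a) *v v) = V_rep (Osp a) *v (M *v v)"
  using centralizer_V_simps[OF assms] by (simp add: matrix_vector_mul_assoc)

lemma X_mat_centralizer: "X_mat \<in> carrier (osp_centralizer V_rep)"
  and Y_mat_centralizer: "Y_mat \<in> carrier (osp_centralizer V_rep)"
  and w_mat_centralizer: "w_mat \<in> carrier (osp_centralizer V_rep)"
  and Z_mat_centralizer: "Z_mat \<in> carrier (osp_centralizer V_rep)"
proof -
  note f = fund_osp_rep
  note ff = tensor_osp_rep[OF f f]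
  have lin: "smat c (mat 1) + smat d A \<in> carrier (osp_centralizer \<rho>)"
    if "A \<in> carrier (osp_centralizer \<rho>)" for A c d and \<rho> :: "uosp_gen \<Rightarrow> 'n::finite cmat"
    using that by (simp add: centralizer_iff_basis matrix_add_ldistrib matrix_add_rdistr smat_mult)
  have mid_eq: "mid_casimir = smat (1/2) (mat 1)
      + smat (- 1/2) (grade_casimir (tensor_rep fund_rep fund_rep))"
    by (simp add: mid_casimir_def vec_eq_iff smat_def algebra_simps)
  have mid: "mid_casimir \<in> carrier (osp_centralizer (tensor_rep fund_rep fund_rep))"
    unfolding mid_eq by (intro lin grade_casimir_centralizer ff)
  \<comment> \<open>\<open>Y_mat\<close> acts on the last two factors, so commutation with their R
    is required by \<open>kron_centralizer_right\<close>.\<close>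
  have mid_R: "mid_casimir ** tensor_rep fund_rep fund_rep R_inv
      = tensor_rep fund_rep fund_rep R_inv ** mid_casimir"
    unfolding mid_eq using grade_casimir_R[OF ff]
    by (simp only: matrix_add_ldistrib matrix_add_rdistr smat_mult matrix_mul_lid matrix_mul_rid)
  show X: "X_mat \<in> carrier (osp_centralizer V_rep)"
    unfolding X_mat_def V_rep_def by (intro kron_centralizer_left ff f mid)
  show Y: "Y_mat \<in> carrier (osp_centralizer V_rep)"
    unfolding Y_mat_def V_rep_def by (intro reassoc_centralizer kron_centralizer_right ff f mid
        mid_R)
  show w: "w_mat \<in> carrier (osp_centralizer V_rep)"
    unfolding w_mat_def by (intro lin grade_casimir_centralizer V_osp_rep)
  have m: "A ** B ** C = C ** (A ** B)" if "A ** C = C ** A"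
      "B ** C = C ** B" for A B C :: "((3 \<times> 3) \<times> 3) cmat"
  proof -
    have "A ** B ** C = A ** (C ** B)" by (simp only: that(2) flip: matrix_mul_assoc)
    then show ?thesis by (simp only: that(1) matrix_mul_assoc)
  qed
  show "Z_mat \<in> carrier (osp_centralizer V_rep)"
    unfolding centralizer_iff_basis
  proof
    fix a
    have c: "X_mat ** V_rep (Osp a) = V_rep (Osp a) ** X_mat"
        "Y_mat ** V_rep (Osp a) = V_rep (Osp a) ** Y_mat"
      "w_mat ** V_rep (Osp a) = V_rep (Osp a) ** w_mat"
      using X Y w by (simp_all add: centralizer_iff_basis)
    show "Z_mat ** V_rep (Osp a) = V_rep (Osp a) ** Z_mat"
      unfolding Z_mat_def matrix_mult_diff matrix_add_ldistrib matrix_add_rdistr c m[OF c(1,2)]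
          m[OF c(2,1)] ..
  qed
qed

lemma Z_mat_vec: "Z_mat *v v = X_mat *v (Y_mat *v v) + Y_mat *v (X_mat *v v) - X_mat *v v
    - Y_mat *v v - w_mat *v v"
  by (simp add: Z_mat_def matrix_vec_simps)

lemma V_F_plus_b: "V_rep (Osp F_plus) *v bvec i j k =
    tvec (tvec (fund_rep (Osp F_plus) *v evec i) (fund_rep R_inv *v evec j)) (fund_rep R_inv
        *v evec k)
    + tvec (tvec (evec i) (fund_rep (Osp F_plus) *v evec j)) (fund_rep R_inv *v evec k)
    + tvec (tvec (evec i) (evec j)) (fund_rep (Osp F_plus) *v evec k)"
  and V_F_minus_b: "V_rep (Osp F_minus) *v bvec i j k =
    tvec (tvec (fund_rep (Osp F_minus) *v evec i) (fund_rep R_inv *v evec j)) (fund_rep R_inv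
        *v evec k)
    + tvec (tvec (evec i) (fund_rep (Osp F_minus) *v evec j)) (fund_rep R_inv *v evec k)
    + tvec (tvec (evec i) (evec j)) (fund_rep (Osp F_minus) *v evec k)"
  by (simp_all add: V_rep_def matrix_vec_simps kron_tvec tvec_simps del: fund_rep.simps)

section \<open>Faithfulness of the restriction to the zero weight space\<close>

lemma matrix_eq_0_basis:
  assumes "\<And>i j k. M *v bvec i j k = 0"
  shows "M = 0"
proof -
  have "M $ p $ q = 0" for p q
  proof -
    obtain i j k where q: "q = ((i, j), k)" by (metis surj_pair)
    have "axis q (1 :: complex) $ x = (if x = q then 1 else 0)" for q x :: "(3 \<times> 3) \<times> 3"
      by (simp add: axis_def)
    then have "bvec i j k = axis q 1" by (simp add: q vec_eq_iff b_component split_paired_all)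
    then have "M $ p $ q = (M *v bvec i j k) $ p"
      by (simp add: matrix_vector_mult_def axis_def if_distrib[of "\<lambda>x. _ * x"] cong: if_cong)
    then show ?thesis by (simp add: assms)
  qed
  then show ?thesis by (simp add: vec_eq_iff)
qed

lemma matrix_vec_sum: "M *v (\<Sum>i\<in>I. v i) = (\<Sum>i\<in>I. M *v v i)" for M :: "'n::finite cmat"
  by (induction I rule: infinite_finite_induct) (simp_all add: matrix_vec_simps)

text \<open>If M kills a vector, it also kills the images of this vector under F+ and F-. Starting
  from weight zero, this reaches all basis vectors, one weight step of 1/2 at a time.\<close>

lemma centralizer_eq_0:
  assumes M: "M \<in> carrier (osp_centralizer V_rep)" and t: "\<And>i. M *v eigvec i = 0"
  shows "M = 0"
proof (rule matrix_eq_0_basis)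
  have zero_weight: "M *v u = 0" if "V_rep (Osp H_zero) *v u = 0" for u
  proof -
    have "M *v u = M *v (\<Sum>i\<in>UNIV. eigcoord i u *s eigvec i)"
      using zero_weight_expansion[OF that] by (rule arg_cong)
    then show ?thesis by (simp add: matrix_vec_sum matrix_vec_simps t)
  qed
  have z: "M *v bvec 1 2 3 = 0" "M *v bvec 1 3 2 = 0" "M *v bvec 2 1 3 = 0" "M *v bvec 2 3 1 = 0"
      "M *v bvec 3 1 2 = 0" "M *v bvec 3 2 1 = 0" "M *v bvec 3 3 3 = 0"
    by (rule zero_weight;
      simp add: V_rep_def matrix_vec_simps kron_tvec tvec_simps fund_rep_basis del: fund_rep.simps)+
  note F = centralizer_V_vec[OF M, of F_plus, symmetric] centralizer_V_vec[OF M, of F_minus,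
      symmetric]
  note s = V_F_plus_b V_F_minus_b fund_rep_basis tvec_simps matrix_vec_simps
  have p: "M *v bvec 1 3 3 = 0" "M *v bvec 3 1 3 = 0" "M *v bvec 3 3 1 = 0" "M *v bvec 1 1 2 = 0"
      "M *v bvec 1 2 1 = 0" "M *v bvec 2 1 1 = 0"
  proof -
    \<comment> \<open>Each of these zero weight basis vectors is mapped by F+ to a combination of
      two basis vectors of weight 1/2. The six relations form a cycle whose signs multiply to -1, so
      M b133 is its own negative.\<close>
    have q: "M *v bvec 1 2 1 = M *v bvec 1 3 3" "M *v bvec 1 1 2 = - (M *v bvec 1 3 3)"
        "M *v bvec 2 1 1 = M *v bvec 3 1 3"
      "M *v bvec 3 3 1 = M *v bvec 2 1 1" "M *v bvec 3 1 3 = - (M *v bvec 1 1 2)"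
          "M *v bvec 1 2 1 = - (M *v bvec 3 3 1)"
      using F(1)[of "bvec 1 2 3"] F(1)[of "bvec 1 3 2"] F(1)[of "bvec 2 1 3"] F(1)[of "bvec 2 3 1"]
          F(1)[of "bvec 3 1 2"] F(1)[of "bvec 3 2 1"]
      by (simp_all add: s z del: fund_rep.simps) (simp_all add: vec_eq_iff add_eq_0_iff)
    then have "M *v bvec 1 3 3 = - (M *v bvec 1 3 3)" by simp
    then have "M *v bvec 1 3 3 = 0" by (simp add: vec_eq_iff)
    with q show "M *v bvec 1 3 3 = 0" "M *v bvec 3 1 3 = 0" "M *v bvec 3 3 1 = 0"
        "M *v bvec 1 1 2 = 0" "M *v bvec 1 2 1 = 0" "M *v bvec 2 1 1 = 0"
      by simp_all
  qed
  have p1: "M *v bvec 1 1 3 = 0" "M *v bvec 1 3 1 = 0" "M *v bvec 3 1 1 = 0"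
    using F(1)[of "bvec 1 1 2"] F(1)[of "bvec 1 2 1"] F(1)[of "bvec 2 1 1"]
    by (simp_all add: s p del: fund_rep.simps)
  have p2: "M *v bvec 1 1 1 = 0"
    using F(1)[of "bvec 1 1 3"] by (simp add: s p1 del: fund_rep.simps)
  have m: "M *v bvec 2 3 3 = 0" "M *v bvec 3 2 3 = 0" "M *v bvec 3 3 2 = 0" "M *v bvec 2 2 1 = 0"
      "M *v bvec 2 1 2 = 0" "M *v bvec 1 2 2 = 0"
  proof -
    have q: "M *v bvec 2 1 2 = - (M *v bvec 2 3 3)" "M *v bvec 2 2 1 = M *v bvec 2 3 3"
        "M *v bvec 1 2 2 = - (M *v bvec 3 2 3)"
      "M *v bvec 1 2 2 = - (M *v bvec 3 3 2)" "M *v bvec 2 2 1 = - (M *v bvec 3 2 3)"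
          "M *v bvec 3 3 2 = M *v bvec 2 1 2"
      using F(2)[of "bvec 1 2 3"] F(2)[of "bvec 1 3 2"] F(2)[of "bvec 2 1 3"] F(2)[of "bvec 2 3 1"]
          F(2)[of "bvec 3 1 2"] F(2)[of "bvec 3 2 1"]
      by (simp_all add: s z del: fund_rep.simps) (simp_all add: vec_eq_iff add_eq_0_iff)
    \<comment> \<open>The signs in \<open>q\<close> multiply to 1 around the cycle, so
      \<open>q\<close> by itself leaves one free vector. The image of b333 under F- provides the
      missing relation.\<close>
    show "M *v bvec 2 3 3 = 0" "M *v bvec 3 2 3 = 0" "M *v bvec 3 3 2 = 0" "M *v bvec 2 2 1 = 0"
        "M *v bvec 2 1 2 = 0" "M *v bvec 1 2 2 = 0"
      using q F(2)[of "bvec 3 3 3"]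
      by (simp_all add: s z del: fund_rep.simps)
  qed
  have m1: "M *v bvec 2 2 3 = 0" "M *v bvec 2 3 2 = 0" "M *v bvec 3 2 2 = 0"
    using F(2)[of "bvec 2 2 1"] F(2)[of "bvec 2 1 2"] F(2)[of "bvec 1 2 2"]
    by (simp_all add: s m del: fund_rep.simps)
  have m2: "M *v bvec 2 2 2 = 0"
    using F(2)[of "bvec 2 2 3"] by (simp add: s m1 del: fund_rep.simps)
  have "\<forall>i j k. M *v bvec i j k = 0"
    unfolding forall_3 using z p p1 p2 m m1 m2 by (intro conjI) assumption
  then show "M *v bvec i j k = 0" for i j k by blast
qed

lemma centralizer_eqI:
  assumes "M \<in> carrier (osp_centralizer V_rep)" "N \<in> carrier (osp_centralizer V_rep)"
      "\<And>i. M *v eigvec i = N *v eigvec i"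
  shows "M = N"
proof -
  have "M - N \<in> carrier (osp_centralizer V_rep)"
    using assms(1,2) by (simp add: centralizer_iff_basis matrix_mult_diff)
  then have "M - N = 0" by (rule centralizer_eq_0) (simp add: matrix_vec_simps assms(3))
  then show ?thesis by simp
qed

lemma eigcoord_sum: "eigcoord i (\<Sum>l\<in>UNIV. c l *s eigvec l) = c i"
  by (cases i) (simp_all add: sum_bi_ix eigcoord_linear eigcoord_eigvec del: eigcoord.simps
      eigvec.simps)

text \<open>M commutes with H, so it preserves the zero weight space; it commutes with
  \<open>w_mat\<close> there, so it is block diagonal with respect to the eigenvalues of
  omega.\<close>

lemma centralizer_eigvec:
  assumes M: "M \<in> carrier (osp_centralizer V_rep)"
  shows "M *v eigvec j = (\<Sum>i\<in>UNIV. eigcoord i (M *v eigvec j) *s eigvec i)"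
    and "omega_ev i \<noteq> omega_ev j \<Longrightarrow> eigcoord i (M *v eigvec j) = 0"
proof -
  have exp: "M *v eigvec l = (\<Sum>i\<in>UNIV. eigcoord i (M *v eigvec l) *s eigvec i)" for l
    by (rule zero_weight_expansion) (simp add: eigvec_zero_weight matrix_vec_simps flip:
        centralizer_V_vec[OF M])
  then show "M *v eigvec j = (\<Sum>i\<in>UNIV. eigcoord i (M *v eigvec j) *s eigvec i)" .
  let ?u = "M *v eigvec j"
  \<comment> \<open>Commutation of M with R is not part of being in the centralizer, but
    \<open>w_mat\<close> contains R. On zero weight vectors R is the scalar -1, which makes M
    commute with \<open>w_mat\<close> there.\<close>
  have R: "V_rep R_inv *v ?u = - ?u"
    by (subst (1 2) exp) (simp add: matrix_vec_sum matrix_vec_simps eigvec_R sum_negf)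
  have "w_mat *v ?u = M *v (w_mat *v eigvec j)"
    by (simp add: w_mat_def matrix_vec_simps grade_casimir_vec R eigvec_R centralizer_V_vec[OF M])
  also have "\<dots> = of_real (omega_ev j) *s ?u" by (simp add: w_mat_eigvec matrix_vec_simps)
  finally have "eigcoord i (w_mat *v ?u)
      = of_real (omega_ev j) * eigcoord i ?u" by (simp add: eigcoord_linear)
  moreover have "w_mat *v ?u = (\<Sum>l\<in>UNIV. (of_real (omega_ev l) * eigcoord l ?u) *s eigvec l)"
    by (subst exp) (simp add: matrix_vec_sum matrix_vec_simps w_mat_eigvec mult.commute)
  then have "eigcoord i (w_mat *v ?u) = of_real (omega_ev i) * eigcoord i ?u"
    by (simp only: eigcoord_sum)
  ultimately show "omega_ev i \<noteq> omega_ev j \<Longrightarrow> eigcoord i ?u = 0" by simp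
qed

section \<open>The defining relations in the centralizer\<close>

text \<open>With the coordinates as explicit arguments, products of operators are evaluated as
  arithmetic on septuples instead of on 27 components.\<close>

definition eig_comb :: "complex \<Rightarrow> complex \<Rightarrow> complex \<Rightarrow> complex \<Rightarrow> complex \<Rightarrow> complex \<Rightarrow> complex \<Rightarrow>
    complex ^ ((3 \<times> 3) \<times> 3)" where
  "eig_comb a1 b1 b2 c1 c2 c3 d1 = a1 *s eigvec A1 + b1 *s eigvec B1 + b2 *s eigvec B2
    + c1 *s eigvec C1 + c2 *s eigvec C2 + c3 *s eigvec C3 + d1 *s eigvec D1"

lemma eigvec_eig_comb:
  "eigvec A1 = eig_comb 1 0 0 0 0 0 0" "eigvec B1 = eig_comb 0 1 0 0 0 0 0"
      "eigvec B2 = eig_comb 0 0 1 0 0 0 0"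
  "eigvec C1 = eig_comb 0 0 0 1 0 0 0" "eigvec C2 = eig_comb 0 0 0 0 1 0 0"
      "eigvec C3 = eig_comb 0 0 0 0 0 1 0"
  "eigvec D1 = eig_comb 0 0 0 0 0 0 1"
  by (simp_all add: eig_comb_def del: eigvec.simps)

lemma eig_comb_simps:
  "eig_comb a1 b1 b2 c1 c2 c3 d1 + eig_comb a1' b1' b2' c1' c2' c3' d1'
    = eig_comb (a1 + a1') (b1 + b1') (b2 + b2') (c1 + c1') (c2 + c2') (c3 + c3') (d1 + d1')"
  "eig_comb a1 b1 b2 c1 c2 c3 d1 - eig_comb a1' b1' b2' c1' c2' c3' d1'
    = eig_comb (a1 - a1') (b1 - b1') (b2 - b2') (c1 - c1') (c2 - c2') (c3 - c3') (d1 - d1')"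
  "c *s eig_comb a1 b1 b2 c1 c2 c3 d1
    = eig_comb (c * a1) (c * b1) (c * b2) (c * c1) (c * c2) (c * c3) (c * d1)"
  "- eig_comb a1 b1 b2 c1 c2 c3 d1 = eig_comb (- a1) (- b1) (- b2) (- c1) (- c2) (- c3) (- d1)"
  "eig_comb 0 0 0 0 0 0 0 = 0"
  by (simp_all add: eig_comb_def vec_eq_iff algebra_simps del: eigvec.simps)

lemma mat_eig_comb:
  "X_mat *v eig_comb a1 b1 b2 c1 c2 c3 d1
      = eig_comb (- 2 * a1) (- 2 * b1) (2 * b2) (- 2 * c1) (2 * c2) 0 (2 * d1)"
  "w_mat *v eig_comb a1 b1 b2 c1 c2 c3 d1
      = eig_comb (14 * a1) (- 4 * b1) (- 4 * b2) (8 * c1) (8 * c2) (8 * c3) (2 * d1)"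
  "Y_mat *v eig_comb a1 b1 b2 c1 c2 c3 d1
      = eig_comb (- 2 * a1) (b1 - b2) (- 3 * b1 - b2) (- c1 - c2)
    (c1 + 5 * c2 + 2 * c3) (- 8 * c2 - 4 * c3) (2 * d1)"
  by (simp_all add: eig_comb_def matrix_vec_simps X_mat_eigvec w_mat_eigvec Y_mat_eigvec sum_bi_ix
      del: eigvec.simps)
    (simp_all add: vec_eq_iff algebra_simps del: eigvec.simps)

lemma Z_mat_eig_comb:
  "Z_mat *v eig_comb a1 b1 b2 c1 c2 c3 d1 = eig_comb (- 2 * a1) (b1 + b2) (3 * b1 - b2) (c2 - c1)
    (- c1 + 5 * c2 + 2 * c3) (- 8 * c2 - 4 * c3) (2 * d1)"
  by (simp add: Z_mat_vec mat_eig_comb eig_comb_simps) (simp add: eig_comb_def vec_eq_iff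
      algebra_simps del: eigvec.simps)

section \<open>Evaluation of the generators and verification of the relations\<close>

fun bi_mat :: "bi_gen \<Rightarrow> ((3 \<times> 3) \<times> 3) cmat" where
  "bi_mat BI_X = X_mat" | "bi_mat BI_Y = Y_mat" | "bi_mat BI_Z = Z_mat" | "bi_mat _ = w_mat"

definition bi_eval :: "bi_gen falg \<Rightarrow> ((3 \<times> 3) \<times> 3) cmat" where "bi_eval = eval_falg bi_mat"

lemma bi_mat_centralizer: "bi_mat g \<in> carrier (osp_centralizer V_rep)"
  by (cases g) (simp_all add: X_mat_centralizer Y_mat_centralizer Z_mat_centralizer
      w_mat_centralizer)

lemma eval_falg_centralizer:
  assumes "\<And>g. G g \<in> carrier (osp_centralizer \<rho>)"
  shows "eval_falg G p \<in> carrier (osp_centralizer \<rho>)"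
proof -
  interpret C: calgebra "osp_centralizer \<rho>" by (rule calgebra_osp_centralizer)
  have ops: "x ** y = x \<otimes>\<^bsub>osp_centralizer \<rho>\<^esub> y" "x + y = x \<oplus>\<^bsub>osp_centralizer \<rho>\<^esub> y"
    "mat 1 = \<one>\<^bsub>osp_centralizer \<rho>\<^esub>" "smat c x = c \<odot>\<^bsub>osp_centralizer \<rho>\<^esub> x" for x y c
    by (simp_all add: osp_centralizer_def)
  have w: "eval_word G u \<in> carrier (osp_centralizer \<rho>)" for u
    by (induction u) (simp_all add: ops assms)
  show ?thesis
    by (induction p rule: falg_induct) (simp_all add: eval_falg_single eval_falg_add ops w)
qed

lemma eval_falg_calg_hom:
  assumes "\<And>g. G g \<in> carrier (osp_centralizer \<rho>)"
  shows "eval_falg G \<in> calg_hom free_calg (osp_centralizer \<rho>)"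
  unfolding calg_hom_def
proof (intro CollectI conjI allI ballI ring_hom_memI)
  show "eval_falg G (c \<odot>\<^bsub>free_calg\<^esub> p) = c \<odot>\<^bsub>osp_centralizer \<rho>\<^esub> eval_falg G p" for c p
    using eval_falg_hom(6)[of G c p] by (simp add: free_calg_def osp_centralizer_def)
next
  show "eval_falg G p \<in> carrier (osp_centralizer \<rho>)" for p
    by (intro eval_falg_centralizer assms)
qed (simp_all add: free_calg_def osp_centralizer_def eval_falg_hom eval_falg_mult eval_falg_add)

lemma zero_centralizer: "0 \<in> carrier (osp_centralizer \<rho>)"
  by (simp add: centralizer_iff_basis matrix_mult_diff)

text \<open>Values of \<open>bi_eval\<close> lie in the centralizer, whose elements are determined
  on the zero weight space, so a relation has to be tested on seven vectors only.\<close>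

lemma bi_eval_eq_0:
  assumes "\<And>i. bi_eval p *v eigvec i = 0"
  shows "bi_eval p = 0"
  using assms unfolding bi_eval_def
  by (intro centralizer_eqI eval_falg_centralizer bi_mat_centralizer zero_centralizer) simp

lemma bi_eval_simps:
  "bi_eval (p + q) *v v = bi_eval p *v v + bi_eval q *v v"
      "bi_eval (p - q) *v v = bi_eval p *v v - bi_eval q *v v"
  "bi_eval (p * q) *v v = bi_eval p *v (bi_eval q *v v)" "bi_eval (gen g) = bi_mat g"
      "bi_eval (numeral n) *v v = numeral n *s v"
  "bi_eval (p ^ 2) *v v = bi_eval p *v (bi_eval p *v v)"
  by (simp_all add: bi_eval_def eval_falg_hom eval_falg_add eval_falg_mult matrix_vec_simps
      power2_eq_square)

lemma bi_eval_bi_rels: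
  assumes "p \<in> bi_rels"
  shows "bi_eval p *v eigvec i = 0"
proof -
  note s = bi_eval_simps mat_eig_comb Z_mat_eig_comb eig_comb_simps eigvec_eig_comb
  have "bi_eval (gen BI_X * gen BI_Y + gen BI_Y * gen BI_X - (gen BI_X + gen BI_Y + gen BI_Z
      + gen BI_omega_Z)) *v eigvec i = 0"
    "bi_eval (gen BI_X * gen BI_Z + gen BI_Z * gen BI_X - (gen BI_X + gen BI_Y + gen BI_Z
        + gen BI_omega_Y)) *v eigvec i = 0"
    "bi_eval (gen BI_Y * gen BI_Z + gen BI_Z * gen BI_Y - (gen BI_X + gen BI_Y + gen BI_Z
        + gen BI_omega_X)) *v eigvec i = 0"
    by (cases i; simp add: s del: eigvec.simps)+
  moreover have "bi_eval (gen h * gen g - gen g * gen h) *v eigvec i = 0"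
    if "h \<in> {BI_omega_X, BI_omega_Y, BI_omega_Z}" for g h
    using that by (cases g; cases i; auto simp add: s simp del: eigvec.simps)
  ultimately show ?thesis
    using assms unfolding bi_rels_def Let_def by blast
qed

lemma bi_eval_bi_bar_rels:
  assumes "p \<in> bi_bar_rels"
  shows "bi_eval p *v eigvec i = 0"
proof -
  note s = bi_eval_simps mat_eig_comb Z_mat_eig_comb eig_comb_simps eigvec_eig_comb
  have "bi_eval (gen BI_omega_Y - gen BI_omega_X) *v eigvec i = 0"
      "bi_eval (gen BI_omega_Z - gen BI_omega_X) *v eigvec i = 0"
    by (cases i; simp add: s del: eigvec.simps)+
  moreover have "bi_eval (gen h * ((gen h)^2 - 4)) *v eigvec i = 0" if "h \<in> {BI_X, BI_Y, BI_Z}"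
      for h
    using that by (cases i; auto simp add: s simp del: eigvec.simps)
  moreover have "bi_eval (bi_septic (gen BI_omega_X) (gen h)) *v eigvec i = 0"
      if "h \<in> {BI_X, BI_Y, BI_Z}" for h
    using that unfolding bi_septic_def by (cases i; auto simp add: s simp del: eigvec.simps)
  moreover have "bi_eval ((gen BI_omega_X + 4) * (gen BI_omega_X - 2) * (gen BI_omega_X
      - 8) * (gen BI_omega_X - 14)) *v eigvec i = 0"
    by (cases i; simp add: s del: eigvec.simps)
  ultimately show ?thesis
    using assms unfolding bi_bar_rels_def Let_def by blast
qed

lemma bi_eval_rels: "p \<in> bi_rels \<union> bi_bar_rels \<Longrightarrow> bi_eval p = 0"
  by (rule bi_eval_eq_0) (use bi_eval_bi_rels bi_eval_bi_bar_rels in blast)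

section \<open>The isomorphism\<close>

lemma calg_hom_compose:
  assumes "\<phi> \<in> calg_hom A B" "\<psi> \<in> calg_hom B C"
  shows "(\<lambda>x. \<psi> (\<phi> x)) \<in> calg_hom A C"
  using assms unfolding calg_hom_def ring_hom_def by (simp add: Pi_iff)

lemma bi_rels_subset: "bi_rels \<subseteq> carrier free_calg"
  by (simp add: free_calg_def)

lemma bi_bar_rels_subset: "calg_proj free_calg bi_rels ` bi_bar_rels \<subseteq> carrier bannai_ito"
  by (simp add: bannai_ito_def calgebra.carrier_calg_quot[OF calgebra_free_calg] image_mono)
    (simp add: free_calg_def image_mono)

section \<open>The two-step projection and the homomorphism to the centralizer\<close>

definition bi_proj :: "bi_gen falg \<Rightarrow> bi_gen falg set set" where
  "bi_proj p = calg_proj bannai_ito (calg_proj free_calg bi_rels ` bi_bar_rels) (calg_proj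
      free_calg bi_rels p)"

lemma bi_proj_hom: "bi_proj \<in> calg_hom free_calg bannai_ito_bar"
proof -
  have 1: "calg_proj free_calg bi_rels \<in> calg_hom free_calg bannai_ito"
    unfolding bannai_ito_def by (rule calgebra.calg_proj_hom[OF calgebra_free_calg bi_rels_subset])
  have 2: "calg_proj bannai_ito (calg_proj free_calg bi_rels ` bi_bar_rels) \<in> calg_hom bannai_ito
      bannai_ito_bar"
    unfolding bannai_ito_bar_def by (rule calgebra.calg_proj_hom[OF calgebra_bannai_ito
        bi_bar_rels_subset])
  show ?thesis
    unfolding bi_proj_def[abs_def] by (rule calg_hom_compose[OF 1 2])
qed

lemma carrier_bannai_ito_bar: "carrier bannai_ito_bar = range bi_proj"
proof -
  have "carrier bannai_ito = range (calg_proj free_calg bi_rels)"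
    unfolding bannai_ito_def calgebra.carrier_calg_quot[OF calgebra_free_calg] by (simp add:
        free_calg_def)
  then show ?thesis
    unfolding bannai_ito_bar_def calgebra.carrier_calg_quot[OF calgebra_bannai_ito]
    by (auto simp: bi_proj_def)
qed

lemma bi_proj_rels:
  assumes "p \<in> bi_rels \<union> bi_bar_rels"
  shows "bi_proj p = \<zero>\<^bsub>bannai_ito_bar\<^esub>"
  using assms
proof
  assume "p \<in> bi_rels"
  then have 1: "calg_proj free_calg bi_rels p = \<zero>\<^bsub>bannai_ito\<^esub>"
    unfolding bannai_ito_def by (rule calgebra.calg_proj_eq_zero[OF calgebra_free_calg
        bi_rels_subset])
  interpret A: calgebra bannai_ito by (rule calgebra_bannai_ito)
  interpret B: calgebra bannai_ito_bar by (rule calgebra_bannai_ito_bar)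
  have "calg_proj bannai_ito (calg_proj free_calg bi_rels ` bi_bar_rels) \<in> ring_hom bannai_ito
      bannai_ito_bar"
    using calgebra.calg_proj_hom[OF calgebra_bannai_ito bi_bar_rels_subset]
    by (simp add: calg_hom_def bannai_ito_bar_def)
  from ring_hom_zero[OF this A.ring_axioms B.ring_axioms] show ?thesis
    by (simp add: bi_proj_def 1)
next
  assume "p \<in> bi_bar_rels"
  then show ?thesis
    unfolding bi_proj_def bannai_ito_bar_def
    by (intro calgebra.calg_proj_eq_zero[OF calgebra_bannai_ito bi_bar_rels_subset] imageI)
qed

text \<open>The quotient is formed in two stages, so the universal property is applied twice: first
  to the defining relations of the Bannai--Ito algebra, then to the additional ones.\<close>

lemma bi_eval_factors:
  obtains \<psi> where "\<psi> \<in> calg_hom bannai_ito_bar (osp_centralizer V_rep)"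
      "\<And>p. \<psi> (bi_proj p) = bi_eval p"
proof -
  have hom: "bi_eval \<in> calg_hom free_calg (osp_centralizer V_rep)"
    unfolding bi_eval_def by (rule eval_falg_calg_hom[OF bi_mat_centralizer])
  have zero: "\<zero>\<^bsub>osp_centralizer V_rep\<^esub> = 0" by (simp add: osp_centralizer_def)
  have car: "x \<in> carrier free_calg" for x by (simp add: free_calg_def)
  obtain \<phi> where \<phi>: "\<phi> \<in> calg_hom bannai_ito (osp_centralizer V_rep)"
      "\<And>p. \<phi> (calg_proj free_calg bi_rels p) = bi_eval p"
    using calgebra.calg_quot_induced_hom[OF calgebra_free_calg calgebra_osp_centralizer
        bi_rels_subset hom]
      bi_eval_rels car zero unfolding bannai_ito_def by (metis UnI1)
  obtain \<psi> where \<psi>: "\<psi> \<in> calg_hom bannai_ito_bar (osp_centralizer V_rep)"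
      "\<And>x. x \<in> carrier bannai_ito
          \<Longrightarrow> \<psi> (calg_proj bannai_ito (calg_proj free_calg bi_rels ` bi_bar_rels) x) = \<phi> x"
  proof (rule calgebra.calg_quot_induced_hom[OF calgebra_bannai_ito calgebra_osp_centralizer
      bi_bar_rels_subset \<phi>(1)])
    show "\<phi> x = \<zero>\<^bsub>osp_centralizer V_rep\<^esub>" if "x \<in> calg_proj free_calg bi_rels ` bi_bar_rels" for x
      using that bi_eval_rels by (auto simp: \<phi>(2) zero)
  qed (use that in \<open>simp only: bannai_ito_bar_def\<close>)
  have "\<psi> (bi_proj p) = bi_eval p" for p
  proof -
    have "calg_proj free_calg bi_rels p \<in> carrier bannai_ito"
      unfolding bannai_ito_def calgebra.carrier_calg_quot[OF calgebra_free_calg] by (simp add: car)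
    then show ?thesis by (simp add: bi_proj_def \<psi>(2) \<phi>(2))
  qed
  with \<psi>(1) show thesis by (rule that)
qed

text \<open>A type-class copy of the record algebra \<open>bannai_ito_bar\<close>, in which the results of the locale
  \<open>bannai_ito_relations\<close> apply.\<close>

typedef biq = "carrier bannai_ito_bar"
  using carrier_bannai_ito_bar by blast

interpretation bib: calgebra bannai_ito_bar by (rule calgebra_bannai_ito_bar)

text \<open>The class structure below carries the real scalars; complex scalars are kept as a
  separate operation that extends them.\<close>

definition biq_scale :: "complex \<Rightarrow> biq \<Rightarrow> biq" where
  "biq_scale c x = Abs_biq (c \<odot>\<^bsub>bannai_ito_bar\<^esub> Rep_biq x)"

definition biq_of :: "bi_gen falg \<Rightarrow> biq" where "biq_of p = Abs_biq (bi_proj p)"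

instantiation biq :: real_algebra_1
begin

definition "0 = Abs_biq \<zero>\<^bsub>bannai_ito_bar\<^esub>"
definition "1 = Abs_biq \<one>\<^bsub>bannai_ito_bar\<^esub>"
definition "x + y = Abs_biq (Rep_biq x \<oplus>\<^bsub>bannai_ito_bar\<^esub> Rep_biq y)"
definition "x * y = Abs_biq (Rep_biq x \<otimes>\<^bsub>bannai_ito_bar\<^esub> Rep_biq y)"
definition "- x = Abs_biq (\<ominus>\<^bsub>bannai_ito_bar\<^esub> Rep_biq x)"
definition "x - y = Abs_biq (Rep_biq x \<ominus>\<^bsub>bannai_ito_bar\<^esub> Rep_biq y)"
definition "r *\<^sub>R x = biq_scale (of_real r) x"

lemma Rep_biq_simps:
  "Rep_biq 0 = \<zero>\<^bsub>bannai_ito_bar\<^esub>" "Rep_biq 1 = \<one>\<^bsub>bannai_ito_bar\<^esub>"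
  "Rep_biq (x + y) = Rep_biq x \<oplus>\<^bsub>bannai_ito_bar\<^esub> Rep_biq y"
  "Rep_biq (x * y) = Rep_biq x \<otimes>\<^bsub>bannai_ito_bar\<^esub> Rep_biq y"
  "Rep_biq (- x) = \<ominus>\<^bsub>bannai_ito_bar\<^esub> Rep_biq x"
  "Rep_biq (x - y) = Rep_biq x \<ominus>\<^bsub>bannai_ito_bar\<^esub> Rep_biq y"
  "Rep_biq (biq_scale c x) = c \<odot>\<^bsub>bannai_ito_bar\<^esub> Rep_biq x"
  "Rep_biq (r *\<^sub>R x) = of_real r \<odot>\<^bsub>bannai_ito_bar\<^esub> Rep_biq x"
  using Rep_biq[of x] Rep_biq[of y]
  by (simp_all add: zero_biq_def one_biq_def plus_biq_def times_biq_def uminus_biq_def minus_biq_def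
      scaleR_biq_def biq_scale_def Abs_biq_inverse)

instance
proof
  note s = Rep_biq_inject[symmetric] Rep_biq_simps Rep_biq
  fix x y z :: biq and a b :: real
  show "x + y + z = x + (y + z)" "0 + x = x" by (simp_all add: s bib.a_assoc)
  show "x + y = y + x" by (simp add: s bib.a_comm)
  show "- x + x = 0" by (simp add: s bib.l_neg)
  show "x - y = x + - y" by (simp add: s a_minus_def)
  show "x * y * z = x * (y * z)" "1 * x = x" "x * 1 = x" by (simp_all add: s bib.m_assoc)
  show "(x + y) * z = x * z + y * z" by (simp add: s bib.l_distr)
  show "x * (y + z) = x * y + x * z" by (simp add: s bib.r_distr)
  show "a *\<^sub>R (x + y) = a *\<^sub>R x + a *\<^sub>R y" by (simp add: s bib.smult_r_distr)
  show "(a + b) *\<^sub>R x = a *\<^sub>R x + b *\<^sub>R x" by (simp add: s bib.smult_l_distr)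
  show "a *\<^sub>R b *\<^sub>R x = (a * b) *\<^sub>R x" by (simp add: s bib.smult_assoc1)
  show "1 *\<^sub>R x = x" by (simp add: s bib.smult_one)
  show "a *\<^sub>R x * y = a *\<^sub>R (x * y)" by (simp add: s bib.smult_mult_l)
  show "x * a *\<^sub>R y = a *\<^sub>R (x * y)" by (simp add: s bib.smult_mult_r)
  \<comment> \<open>A collapse of the quotient would pass through the homomorphism to the
    centralizer and give 1 = 0 for matrices.\<close>
  show "(0 :: biq) \<noteq> 1"
  proof
    assume "(0 :: biq) = 1"
    then have eq: "\<zero>\<^bsub>bannai_ito_bar\<^esub> = \<one>\<^bsub>bannai_ito_bar\<^esub>" by (simp add: s)
    interpret C: calgebra "osp_centralizer V_rep" by (rule calgebra_osp_centralizer)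
    obtain \<psi> where \<psi>: "\<psi> \<in> ring_hom bannai_ito_bar (osp_centralizer V_rep)"
      using bi_eval_factors by (metis (lifting) calg_hom_def mem_Collect_eq)
    have "\<zero>\<^bsub>osp_centralizer V_rep\<^esub> = \<one>\<^bsub>osp_centralizer V_rep\<^esub>"
      using ring_hom_zero[OF \<psi> bib.ring_axioms C.ring_axioms] ring_hom_one[OF \<psi>] eq by simp
    then have "(mat 1 :: ((3 \<times> 3) \<times> 3) cmat) = 0" by (simp add: osp_centralizer_def)
    then have "(mat 1 :: ((3 \<times> 3) \<times> 3) cmat) $ ((1, 1), 1) $ ((1, 1), 1) = 0" by (subst \<open>mat 1
        = 0\<close>) simp
    then show False by (simp add: mat_def)
  qed
qed

end

section \<open>Complex scalars and generators in the type copy\<close>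

lemma biq_scale_simps:
  "biq_scale c (x + y) = biq_scale c x + biq_scale c y"
      "biq_scale (c + d) x = biq_scale c x + biq_scale d x"
      "biq_scale c (biq_scale d x) = biq_scale (c * d) x"
  "biq_scale c x * y = biq_scale c (x * y)" "x * biq_scale c y = biq_scale c (x * y)"
      "r *\<^sub>R x = biq_scale (of_real r) x" "biq_scale 1 x = x"
  by (simp_all add: Rep_biq_inject[symmetric] Rep_biq_simps Rep_biq bib.smult_r_distr
      bib.smult_l_distr
     bib.smult_assoc1 bib.smult_mult_l bib.smult_mult_r bib.smult_one)

lemma biq_scale_0: "biq_scale 0 x = 0" "biq_scale c 0 = 0"
  using biq_scale_simps(2)[of 0 0 x] biq_scale_simps(1)[of c 0 0] by simp_all

lemma biq_scale_minus: "biq_scale (- c) x = - biq_scale c x"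
  using biq_scale_simps(2)[of c "- c" x] by (simp add: biq_scale_0 add_eq_0_iff)

lemma biq_scale_sum: "biq_scale c (sum f A) = (\<Sum>i\<in>A. biq_scale c (f i))"
  by (induction A rule: infinite_finite_induct) (simp_all add: biq_scale_0 biq_scale_simps)

lemma biq_of_simps:
  "biq_of (p + q) = biq_of p + biq_of q" "biq_of (p * q) = biq_of p * biq_of q" "biq_of 1 = 1"
      "biq_of (Poly_Mapping.single 0 c * p) = biq_scale c (biq_of p)"
proof -
  have "Rep_biq (biq_of p) = bi_proj p" for p
    unfolding biq_of_def by (rule Abs_biq_inverse) (simp add: carrier_bannai_ito_bar)
  note s = Rep_biq_inject[symmetric] Rep_biq_simps this
  have h: "bi_proj \<in> ring_hom free_calg bannai_ito_bar"
      "\<And>c x. bi_proj (c \<odot>\<^bsub>free_calg\<^esub> x) = c \<odot>\<^bsub>bannai_ito_bar\<^esub> bi_proj x"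
  proof -
    show "bi_proj \<in> ring_hom free_calg bannai_ito_bar" using bi_proj_hom by (simp add: calg_hom_def)
    show "bi_proj (c \<odot>\<^bsub>free_calg\<^esub> x) = c \<odot>\<^bsub>bannai_ito_bar\<^esub> bi_proj x" for c x
    proof -
      have "x \<in> carrier free_calg" by (simp add: free_calg_def)
      then show ?thesis using bi_proj_hom unfolding calg_hom_def by blast
    qed
  qed
  show "biq_of (p + q) = biq_of p + biq_of q" "biq_of (p * q) = biq_of p * biq_of q"
      "biq_of 1 = 1" "biq_of (Poly_Mapping.single 0 c * p) = biq_scale c (biq_of p)"
    using ring_hom_add[OF h(1), of p q] ring_hom_mult[OF h(1), of p q] ring_hom_one[OF h(1)]
        h(2)[of c p]
    by (simp_all add: s free_calg_def)
qed

lemma biq_of_0: "biq_of 0 = 0" using biq_of_simps(1)[of 0 0] by simp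
lemma biq_of_minus: "biq_of (- p) = - biq_of p" using biq_of_simps(1)[of p "- p"] by (simp add:
    biq_of_0 add_eq_0_iff)
lemma biq_of_diff: "biq_of (p - q) = biq_of p
    - biq_of q" using biq_of_simps(1)[of p "- q"] by (simp add: biq_of_minus)
lemma biq_of_numeral: "biq_of (numeral n) = numeral n *\<^sub>R 1"
proof -
  have "biq_of (of_nat k) = of_nat k" for k by (induction k) (simp_all add: biq_of_0 biq_of_simps)
  from this[of "numeral n"] show ?thesis by (simp add: scaleR_conv_of_real)
qed

lemma biq_of_rels: "p \<in> bi_rels \<union> bi_bar_rels \<Longrightarrow> biq_of p = 0"
  by (simp add: biq_of_def bi_proj_rels zero_biq_def)

lemma surj_biq_of: "surj biq_of"
proof -
  have "\<exists>p. x = biq_of p" for x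
    using Rep_biq[of x] unfolding carrier_bannai_ito_bar biq_of_def by (metis Rep_biq_inverse
        imageE)
  then show ?thesis by (auto simp: surj_def)
qed

lemma biq_of_omega: "biq_of (gen BI_omega_Y) = biq_of (gen BI_omega_X)"
    "biq_of (gen BI_omega_Z) = biq_of (gen BI_omega_X)"
proof -
  have "gen BI_omega_Y - gen BI_omega_X \<in> bi_bar_rels"
      "gen BI_omega_Z - gen BI_omega_X \<in> bi_bar_rels"
    by (simp_all add: bi_bar_rels_def Let_def)
  from this[THEN UnI2, THEN biq_of_rels] show "biq_of (gen BI_omega_Y) = biq_of (gen BI_omega_X)"
      "biq_of (gen BI_omega_Z) = biq_of (gen BI_omega_X)"
    by (simp_all add: biq_of_diff)
qed

interpretation Q: bannai_ito_relations "biq_of (gen BI_X)" "biq_of (gen BI_Y)" "biq_of (gen BI_Z)"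
    "biq_of (gen BI_omega_X)"
proof
  let ?X = "gen BI_X" and ?Y = "gen BI_Y" and ?Z = "gen BI_Z" and ?w = "gen BI_omega_X"
  note s = biq_of_diff biq_of_simps(1-3) biq_of_numeral biq_of_omega
  have r: "?X * ?Y + ?Y * ?X - (?X + ?Y + ?Z + gen BI_omega_Z) \<in> bi_rels"
    "?X * ?Z + ?Z * ?X - (?X + ?Y + ?Z + gen BI_omega_Y) \<in> bi_rels"
    "?Y * ?Z + ?Z * ?Y - (?X + ?Y + ?Z + ?w) \<in> bi_rels"
    "?w * gen g - gen g * ?w \<in> bi_rels" for g
    unfolding bi_rels_def Let_def by blast+
  note r' = r[THEN UnI1, THEN biq_of_rels]
  show "biq_of ?X * biq_of ?Y + biq_of ?Y * biq_of ?X
      = biq_of ?X + biq_of ?Y + biq_of ?Z + biq_of ?w"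
    "biq_of ?X * biq_of ?Z + biq_of ?Z * biq_of ?X = biq_of ?X + biq_of ?Y + biq_of ?Z + biq_of ?w"
    "biq_of ?Y * biq_of ?Z + biq_of ?Z * biq_of ?Y = biq_of ?X + biq_of ?Y + biq_of ?Z + biq_of ?w"
    "biq_of ?w * biq_of ?X = biq_of ?X * biq_of ?w" "biq_of ?w * biq_of ?Y = biq_of ?Y * biq_of ?w"
    using r'(1) r'(2) r'(3) r'(4)[of BI_X] r'(4)[of BI_Y] by (simp_all add: s)
  have c: "gen h * ((gen h)^2 - 4) \<in> bi_bar_rels" if "h \<in> {BI_X, BI_Y, BI_Z}" for h
    using that unfolding bi_bar_rels_def Let_def by blast
  have "biq_of (gen h) * (biq_of (gen h) * biq_of (gen h)) = 4 *\<^sub>R biq_of (gen h)"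
      if "h \<in> {BI_X, BI_Y, BI_Z}" for h
    using biq_of_rels[OF UnI2[OF c[OF that]]] by (simp add: s power2_eq_square algebra_simps)
  then show "biq_of ?X * (biq_of ?X * biq_of ?X) = 4 *\<^sub>R biq_of ?X"
      "biq_of ?Y * (biq_of ?Y * biq_of ?Y) = 4 *\<^sub>R biq_of ?Y"
      "biq_of ?Z * (biq_of ?Z * biq_of ?Z) = 4 *\<^sub>R biq_of ?Z"
    by simp_all
  have "(?w + 4) * (?w - 2) * (?w - 8) * (?w - 14) \<in> bi_bar_rels" "bi_septic ?w ?X \<in> bi_bar_rels"
    unfolding bi_bar_rels_def Let_def by blast+
  from this[THEN UnI2, THEN biq_of_rels]
  show "(biq_of ?w + 4 *\<^sub>R 1) * (biq_of ?w - 2 *\<^sub>R 1) * (biq_of ?w - 8 *\<^sub>R 1) * (biq_of ?w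
      - 14 *\<^sub>R 1) = 0"
    "(biq_of ?X - biq_of ?w + 16 *\<^sub>R 1) * (biq_of ?X - biq_of ?w + 10 *\<^sub>R 1) * (biq_of ?X
        - biq_of ?w + 8 *\<^sub>R 1) * (biq_of ?X - biq_of ?w + 6 *\<^sub>R 1)
      * (biq_of ?X - biq_of ?w) * (biq_of ?X - biq_of ?w - 2 *\<^sub>R 1) * (biq_of ?X - biq_of ?w
          - 6 *\<^sub>R 1) = 0"
    unfolding bi_septic_def by (simp_all only: s)
qed

section \<open>Spanning by the matrix units\<close>

lemma biq_scale_diff: "biq_scale c x - biq_scale d x = biq_scale (c - d) x"
  using biq_scale_simps(2)[of c "- d" x] by (simp add: biq_scale_minus)

lemma biq_scale_sum_left: "(\<Sum>i\<in>A. biq_scale (c i) x) = biq_scale (\<Sum>i\<in>A. c i) x"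
  by (induction A rule: infinite_finite_induct) (simp_all add: biq_scale_0 biq_scale_simps(2))

lemma matrix_sum_vec: "(\<Sum>i\<in>I. M i) *v v = (\<Sum>i\<in>I. M i *v v)" for M :: "'i \<Rightarrow> 'n::finite cmat"
  by (induction I rule: infinite_finite_induct) (simp_all add: matrix_vec_simps)

text \<open>The span contains all multiples of 1, the sum of the diagonal units, and is stable under
  left multiplication by the generators. Hence it contains every word and therefore
  everything.\<close>

lemma matrix_units_span: "\<exists>c. x = (\<Sum>i\<in>UNIV. \<Sum>j\<in>UNIV. biq_scale (c i j) (Q.E i j))"
proof -
  define S where "S = range (\<lambda>c. \<Sum>i\<in>UNIV. \<Sum>j\<in>UNIV. biq_scale (c i j) (Q.E i j))"
  have S: "(\<Sum>i\<in>UNIV. \<Sum>j\<in>UNIV. biq_scale (c i j) (Q.E i j)) \<in> S" for c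
    unfolding S_def by blast
  have add: "x + y \<in> S" "x - y \<in> S" if xy: "x \<in> S" "y \<in> S" for x y
  proof -
    obtain c where c: "x = (\<Sum>i\<in>UNIV. \<Sum>j\<in>UNIV. biq_scale (c i j) (Q.E i j))"
      using xy(1) unfolding S_def by blast
    obtain d where d: "y = (\<Sum>i\<in>UNIV. \<Sum>j\<in>UNIV. biq_scale (d i j) (Q.E i j))"
      using xy(2) unfolding S_def by blast
    show "x + y \<in> S" "x - y \<in> S"
      using S[of "\<lambda>i j. c i j + d i j"] S[of "\<lambda>i j. c i j - d i j"]
      by (simp_all add: c d biq_scale_simps(2) biq_scale_diff[symmetric] sum.distrib sum_subtractf)
  qed
  let ?X = "biq_of (gen BI_X)" and ?Y = "biq_of (gen BI_Y)" and ?w = "biq_of (gen BI_omega_X)"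
  have X: "?X * x \<in> S" and w: "?w * x \<in> S" and Y: "?Y * x \<in> S" if "x \<in> S" for x
  proof -
    obtain c where x: "x = (\<Sum>i\<in>UNIV. \<Sum>j\<in>UNIV. biq_scale (c i j) (Q.E i j))"
      using \<open>x \<in> S\<close> unfolding S_def by blast
    have "?X * x = (\<Sum>i\<in>UNIV. \<Sum>j\<in>UNIV. biq_scale (c i j * of_real (X_ev i)) (Q.E i j))"
      unfolding x sum_distrib_left biq_scale_simps(5) Q.X_E biq_scale_simps(6) biq_scale_simps(3) ..
    then show "?X * x \<in> S" using S by simp
    have "?w * x = (\<Sum>i\<in>UNIV. \<Sum>j\<in>UNIV. biq_scale (c i j * of_real (omega_ev i)) (Q.E i j))"
      unfolding x sum_distrib_left biq_scale_simps(5) Q.w_E biq_scale_simps(6) biq_scale_simps(3) ..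
    then show "?w * x \<in> S" using S by simp
    have "?Y * x = (\<Sum>i\<in>UNIV. \<Sum>j\<in>UNIV. \<Sum>k\<in>UNIV. biq_scale (c i j * of_real (Y_entry k i)) (Q.E k j))"
      unfolding x sum_distrib_left biq_scale_simps(5) Q.Y_E biq_scale_sum biq_scale_simps(6)
          biq_scale_simps(3) ..
    \<comment> \<open>The exchanges of sums make the index i innermost, so that it is absorbed into
      the coefficient of \<open>E k j\<close>.\<close>
    also have "\<dots> = (\<Sum>j\<in>UNIV. \<Sum>i\<in>UNIV. \<Sum>k\<in>UNIV. biq_scale (c i j * of_real (Y_entry k i)) (Q.E k j))"
      by (rule sum.swap)
    also have "\<dots> = (\<Sum>j\<in>UNIV. \<Sum>k\<in>UNIV. \<Sum>i\<in>UNIV. biq_scale (c i j * of_real (Y_entry k i)) (Q.E k j))"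
      by (rule sum.cong[OF refl], rule sum.swap)
    also have "\<dots> = (\<Sum>k\<in>UNIV. \<Sum>j\<in>UNIV. \<Sum>i\<in>UNIV. biq_scale (c i j * of_real (Y_entry k i)) (Q.E k j))"
      by (rule sum.swap)
    also have "\<dots> = (\<Sum>k\<in>UNIV. \<Sum>j\<in>UNIV. biq_scale (\<Sum>i\<in>UNIV. c i j * of_real (Y_entry k i)) (Q.E k j))"
      by (simp only: biq_scale_sum_left)
    finally show "?Y * x \<in> S" using S by simp
  qed
  have gen: "biq_of (gen g) * x \<in> S" if "x \<in> S" for g x
  proof (cases g)
    case BI_Z
    have "biq_of (gen g) * x = ?X * (?Y * x) + ?Y * (?X * x) - ?X * x - ?Y * x - ?w * x"
      unfolding BI_Z Q.Z_eq by (simp add: algebra_simps)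
    then show ?thesis using that by (simp add: add X Y w)
  qed (use that X Y w in \<open>simp_all add: biq_of_omega\<close>)
  have one: "biq_scale c 1 \<in> S" for c
  proof -
    have "biq_scale c 1 = (\<Sum>i\<in>UNIV. biq_scale c (Q.E i i))"
      by (simp add: Q.E_diag Q.sum_P flip: biq_scale_sum)
    also have "\<dots> = (\<Sum>i\<in>UNIV. \<Sum>j\<in>UNIV. biq_scale (if i = j then c else 0) (Q.E i j))"
      by (simp add: if_distrib[of "\<lambda>a. biq_scale a _"] biq_scale_0 cong: if_cong)
    finally show ?thesis using S by simp
  qed
  have word: "biq_of (Poly_Mapping.single (Word u) c) \<in> S" for u c
  proof (induction u)
    case Nil
    have "biq_of (Poly_Mapping.single 0 c * 1) \<in> S"
      using one[of c] by (simp only: biq_of_simps(3,4))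
    then show ?case by (simp add: zero_fmon_def)
  next
    case (Cons g u)
    have "Poly_Mapping.single (Word (g # u)) c = gen g * Poly_Mapping.single (Word u) c"
      by (simp add: gen_def mult_single)
    then show ?case using gen[OF Cons] by (simp only: biq_of_simps)
  qed
  obtain p where "x = biq_of p" using surj_biq_of by blast
  moreover have "biq_of p \<in> S"
    by (induction p rule: falg_induct) (simp_all add: word biq_of_simps add)
  ultimately show ?thesis by (auto simp: S_def)
qed

theorem corollary3p1:
  shows "calg_isomorphic bannai_ito_bar (osp_centralizer V_rep)"
proof -
  let ?C = "osp_centralizer V_rep"
  obtain \<psi> where \<psi>: "\<psi> \<in> calg_hom bannai_ito_bar ?C" and \<psi>_proj: "\<And>p. \<psi> (bi_proj p) = bi_eval p"
    using bi_eval_factors by blast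
  define g where "g x = \<psi> (Rep_biq x)" for x
  have g_pb: "g (biq_of p) = bi_eval p" for p
    unfolding g_def biq_of_def by (subst Abs_biq_inverse) (simp_all add: carrier_bannai_ito_bar
        \<psi>_proj)
  have hom: "\<psi> \<in> ring_hom bannai_ito_bar ?C" using \<psi> by (simp add: calg_hom_def)
  have g_closed: "g x \<in> carrier ?C" for x
    unfolding g_def by (rule ring_hom_closed[OF hom Rep_biq])
  have g: "g (x + y) = g x + g y" "g (x * y) = g x ** g y" "g 1 = mat 1"
      "g (biq_scale c x) = smat c (g x)" for x y c
    using ring_hom_add[OF hom Rep_biq Rep_biq, of x y] ring_hom_mult[OF hom Rep_biq Rep_biq, of x
        y] ring_hom_one[OF hom] \<psi> Rep_biq[of x]
    by (simp_all add: g_def Rep_biq_simps calg_hom_def) (simp_all add: osp_centralizer_def)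
  have g_0: "g 0 = 0" using g(1)[of 0 0] by simp
  have g_minus: "g (- x) = - g x" for x using g(1)[of x "- x"] g_0 by (simp add: add_eq_0_iff)
  have g_sum: "g (sum f A) = (\<Sum>i\<in>A. g (f i))" for f :: "'b \<Rightarrow> biq" and A
    by (induction A rule: infinite_finite_induct) (simp_all add: g_0 g)
  have g_scaleR: "g (r *\<^sub>R x) = smat (of_real r) (g x)"
      for r x by (simp only: biq_scale_simps(6) g(4))
  let ?X = "biq_of (gen BI_X)" and ?Y = "biq_of (gen BI_Y)" and ?w = "biq_of (gen BI_omega_X)"
  have gens: "g ?X = X_mat" "g ?Y = Y_mat" "g ?w = w_mat"
    by (simp_all add: g_pb bi_eval_simps)
  \<comment> \<open>Both \<open>P i * X\<close> and \<open>P i * w\<close> are multiples of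
    \<open>P i\<close>; evaluating them at \<open>eigvec k\<close> in two ways leaves a nonzero
    result only if the joint eigenvalues agree.\<close>
  have P_neq: "g (Q.P i) *v eigvec k = 0" if "i \<noteq> k" for i k
  proof -
    have "g (Q.P i * ?X) *v eigvec k = of_real (X_ev i) *s (g (Q.P i) *v eigvec k)"
      "g (Q.P i * ?w) *v eigvec k = of_real (omega_ev i) *s (g (Q.P i) *v eigvec k)"
      by (simp_all add: Q.P_X Q.P_w g_scaleR matrix_vec_simps)
    then have "of_real (X_ev k) *s (g (Q.P i) *v eigvec k)
        = of_real (X_ev i) *s (g (Q.P i) *v eigvec k)"
      "of_real (omega_ev k) *s (g (Q.P i) *v eigvec k)
          = of_real (omega_ev i) *s (g (Q.P i) *v eigvec k)"
      by (simp_all add: g gens matrix_vec_simps X_mat_eigvec w_mat_eigvec)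
    then show ?thesis
      using joint_spectrum_inj[of i k] that by (auto simp: vector_mul_rcancel)
  qed
  have P_eq: "g (Q.P k) *v eigvec k = eigvec k" for k
  proof -
    have "eigvec k = g (\<Sum>i\<in>UNIV. Q.P i) *v eigvec k" by (simp add: Q.sum_P g matrix_vec_simps)
    also have "\<dots> = (\<Sum>i\<in>UNIV. if i = k then g (Q.P k) *v eigvec k else 0)"
      unfolding g_sum matrix_sum_vec by (rule sum.cong) (auto simp: P_neq)
    finally show ?thesis by simp
  qed
  have P: "g (Q.P i) *v eigvec k = (if i = k then eigvec k else 0)" for i k
    by (simp add: P_neq P_eq)
  have y: "g (Q.y i j) *v eigvec k = (if j = k then of_real (Y_entry i j) *s eigvec i else 0)"
      for i j k
    by (simp add: Q.y_def g gens matrix_vec_simps P Y_mat_eigvec matrix_vec_sum if_distrib[of "\<lambda>v.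
        _ *s v"] cong: if_cong)
  \<comment> \<open>The units between C1 and C3 act through the intermediate vector of C2; those
    between different eigenvalues of omega are 0 by definition.\<close>
  have E_k: "g (Q.E j k) *v eigvec k = (if omega_ev j = omega_ev k then eigvec j else 0)" for j k
    by (cases j; cases k) (simp_all add: P y g g_0 g_minus g_scaleR matrix_vec_simps del:
        eigvec.simps)
  have E: "g (Q.E j i) *v eigvec k = (if i = k \<and> omega_ev j = omega_ev k then eigvec j else 0)"
      for j i k
  proof (cases "i = k")
    case False
    have "g (Q.E j i) *v eigvec k = g (Q.E j i * Q.P i) *v eigvec k" by (simp only: Q.E_P)
    then show ?thesis using False by (simp add: g matrix_vec_simps P)
  qed (simp add: E_k)
  \<comment> \<open>Applying the image to \<open>eigvec k\<close> reads off column k of the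
    coefficients, restricted to the blocks of omega.\<close>
  have expansion: "g (\<Sum>i\<in>UNIV. \<Sum>j\<in>UNIV. biq_scale (c i j) (Q.E i j)) *v eigvec k
      = (\<Sum>i\<in>UNIV. (if omega_ev i = omega_ev k then c i k else 0) *s eigvec i)" for c k
    by (simp add: g_sum g matrix_sum_vec matrix_vec_simps E if_distrib[of "\<lambda>v. _ *s v"]
        if_distrib[of "\<lambda>a. a *s _"]
      if_if_eq_conj[symmetric] cong: if_cong)
  have inj: "x = 0" if "g x = 0" for x
  proof -
    obtain c where x: "x = (\<Sum>i\<in>UNIV. \<Sum>j\<in>UNIV. biq_scale (c i j) (Q.E i j))" using matrix_units_span
        by blast
    \<comment> \<open>Inside a block the coefficient is a coordinate of a zero vector; outside, the
      coefficient is arbitrary but the matrix unit vanishes.\<close>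
    have "biq_scale (c i k) (Q.E i k) = 0" for i k
    proof (cases "omega_ev i = omega_ev k")
      case True
      have "eigcoord i (g x *v eigvec k) = 0" using that by (simp add: eigcoord_linear
          matrix_vector_mult_0)
      then have "c i k = 0" unfolding x expansion eigcoord_sum using True by simp
      then show ?thesis by (simp add: biq_scale_0)
    qed (simp add: Q.E_eq_0 biq_scale_0)
    then show ?thesis by (simp add: x)
  qed
  have surj: "\<exists>x. g x = M" if M: "M \<in> carrier ?C" for M
  proof
    \<comment> \<open>The preimage has as coefficients the matrix entries of M on the eigenbasis.
      The entries outside the blocks are 0, so nothing is lost by the vanishing of the units
      there.\<close>
    let ?x = "\<Sum>i\<in>UNIV. \<Sum>j\<in>UNIV. biq_scale (eigcoord i (M *v eigvec j)) (Q.E i j)"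
    show "g ?x = M"
    proof (rule centralizer_eqI[OF g_closed M])
      fix k
      have "g ?x *v eigvec k = (\<Sum>i\<in>UNIV. eigcoord i (M *v eigvec k) *s eigvec i)"
        unfolding expansion by (rule sum.cong) (auto simp: centralizer_eigvec(2)[OF M])
      then show "g ?x *v eigvec k = M *v eigvec k" using centralizer_eigvec(1)[OF M] by simp
    qed
  qed
  have "inj g"
  proof (rule injI)
    fix x y assume "g x = g y"
    moreover have "g (x - y) = g x - g y" using g(1)[of "x - y" y] by simp
    ultimately show "x = y" using inj[of "x - y"] by simp
  qed
  moreover have "range g = carrier ?C" using g_closed surj by blast
  ultimately have "bij_betw g UNIV (carrier ?C)" by (simp add: bij_betw_def)
  moreover have "bij_betw Abs_biq (carrier bannai_ito_bar) UNIV"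
    by (rule bij_betw_byWitness[of _ Rep_biq]) (auto simp: Abs_biq_inverse Rep_biq_inverse Rep_biq)
  ultimately have "bij_betw (g \<circ> Abs_biq) (carrier bannai_ito_bar) (carrier ?C)"
    by (rule bij_betw_trans[rotated])
  then have "bij_betw \<psi> (carrier bannai_ito_bar) (carrier ?C)"
    by (rule bij_betw_cong[THEN iffD1, rotated]) (simp add: g_def Abs_biq_inverse)
  then have "\<psi> \<in> calg_iso bannai_ito_bar ?C"
    using \<psi> by (simp add: calg_iso_def calg_hom_def ring_iso_def)
  then show ?thesis unfolding calg_isomorphic_def by blast
qed

end
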